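(* Let $u$ be a finite game with strategy space $X$, and let $\phi$ be its replicator flow. Let $x\in X$ be a chain recurrent point of $\phi$. Then there exist a sink connected component $H$ of the response graph of $u$ and a pure profile $y\in H$ such that there is a pseudo-orbit from $x$ to $y$ under $\phi$, and $H$ is contained in a chain component $[H]$ of $\phi$ that is a sink chain component.
   Context: Games. A (finite) game has players $1,\dots,N$, finite non-empty strategy sets $S_1,\dots,S_N$ and a utility function $u:Z\to\mathbb{R}^N$, where $Z=\prod_{i=1}^N S_i$ is the set of (pure) profiles. Two profiles are $i$-comparable if they differ exactly in the strategy of player $i$. The response graph is the directed graph with node set $Z$ and an arc $p\to q$ if and only if $p,q$ are $i$-comparable for some $i$ and $u_i(p)\le u_i(q)$. A set of nodes is attracting if no path (equivalently no arc) leaves it; the sink connected components are the minimal non-empty attracting sets, i.e. the strongly connected components with no outgoing arc. The strategy space is $X=\prod_{i=1}^N\Delta_{|S_i|}$, where $\Delta_{|S_i|}$ is the simplex of probability distributions on $S_i$. For $x\in X$, $x^i_s$ is the probability player $i$ gives to $s\in S_i$. Pure profiles are identified with vertices of $X$. The expected utility is $\mathbb{U}(x)=\sum_{q\in Z}u(q)\prod_{i=1}^N x^i_{q_i}$, and $\mathbb{U}_p(s;\bar x_{-p})$ denotes player $p$'s expected utility when $p$ plays $s$ and the others play according to $x$. Replicator flow. The replicator flow $\phi:X\times\mathbb{R}\to X$ is the flow of the ODE $\dot x^p_s=x^p_s\bigl(\mathbb{U}_p(s;\bar x_{-p})-\sum_{t\in S_p}x^p_t\,\mathbb{U}_p(t;\bar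 x_{-p})\bigr)$. Chains. Let $\mathbf{d}$ be the Euclidean metric on $X$. For $\epsilon,T>0$, an $(\epsilon,T)$-chain from $x$ to $y$ is a finite sequence $x=x_1,x_2,\dots,x_n=y$ with $n\ge 2$ and times $t_1,\dots,t_{n-1}\ge T$ such that $\mathbf{d}(\phi(x_i,t_i),x_{i+1})<\epsilon$ for $1\le i\le n-1$. There is a pseudo-orbit from $x$ to $y$ if there is an $(\epsilon,T)$-chain from $x$ to $y$ for all $\epsilon>0$ and $T>0$. Points $x,y$ are chain equivalent if there are pseudo-orbits from $x$ to $y$ and from $y$ to $x$; $x$ is chain recurrent if it is chain equivalent to itself. Chain equivalence is an equivalence relation on the chain recurrent points; its classes are the chain components. Pseudo-orbits induce a partial order on chain components; a sink chain component is a minimal one, i.e. a chain component $C$ such that whenever $c\in C$, $z$ is chain recurrent and there is a pseudo-orbit from $c$ to $z$, then $z\in C$. All pure profiles of a strongly connected component $H$ of the response graph lie in a single chain component, denoted $[H]$. *)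

theory Defs
  imports "HOL-Analysis.Analysis"
begin

text \<open>
  Players are the elements of a finite type \<^typ>\<open>'p\<close>. The strategy sets \<open>S p\<close> are subsets
  of a common finite type \<^typ>\<open>'s\<close>, so they are finite and may differ from player to player;
  non-emptiness is assumed where it is needed. The utility function \<open>u\<close> only matters on
  \<open>profiles S\<close>.
\<close>

definition profiles :: "('p::finite \<Rightarrow> 's::finite set) \<Rightarrow> ('p \<Rightarrow> 's) set" where
  "profiles S = {q. \<forall>p. q p \<in> S p}"

definition comparable :: "'p::finite \<Rightarrow> ('p \<Rightarrow> 's::finite) \<Rightarrow> ('p \<Rightarrow> 's) \<Rightarrow> bool" where
  "comparable i a b \<longleftrightarrow> a i \<noteq> b i \<and> (\<forall>j. j \<noteq> i \<longrightarrow> a j = b j)"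

definition response_graph ::
  "('p::finite \<Rightarrow> 's::finite set) \<Rightarrow> (('p \<Rightarrow> 's) \<Rightarrow> real ^ 'p) \<Rightarrow> ('p \<Rightarrow> 's) rel" where
  "response_graph S u =
     {(a, b). a \<in> profiles S \<and> b \<in> profiles S \<and> (\<exists>i. comparable i a b \<and> u a $ i \<le> u b $ i)}"

definition attracting ::
  "('p::finite \<Rightarrow> 's::finite set) \<Rightarrow> (('p \<Rightarrow> 's) \<Rightarrow> real ^ 'p) \<Rightarrow> ('p \<Rightarrow> 's) set \<Rightarrow> bool" where
  "attracting S u A \<longleftrightarrow> A \<subseteq> profiles S \<and> (response_graph S u)\<^sup>* `` A \<subseteq> A"

definition sink_connected_component ::
  "('p::finite \<Rightarrow> 's::finite set) \<Rightarrow> (('p \<Rightarrow> 's) \<Rightarrow> real ^ 'p) \<Rightarrow> ('p \<Rightarrow> 's) set \<Rightarrow> bool" where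
  "sink_connected_component S u H \<longleftrightarrow>
     H \<noteq> {} \<and> attracting S u H \<and>
     (\<forall>A. A \<noteq> {} \<and> attracting S u A \<and> A \<subseteq> H \<longrightarrow> A = H)"

text \<open>
  A mixed profile \<open>x\<close> assigns to \<open>s \<in> S p\<close> the probability \<open>x $ p $ s\<close>; coordinates outside
  \<open>S p\<close> vanish. The library metric on \<^typ>\<open>real ^ 's ^ 'p\<close> is therefore the Euclidean
  metric on the strategy space.
\<close>

definition strategy_space :: "('p::finite \<Rightarrow> 's::finite set) \<Rightarrow> (real ^ 's ^ 'p) set" where
  "strategy_space S =
     {x. \<forall>p. (\<forall>s. 0 \<le> x $ p $ s) \<and> (\<forall>s. s \<notin> S p \<longrightarrow> x $ p $ s = 0) \<and> (\<Sum>s\<in>S p. x $ p $ s) = 1}"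

definition pure :: "('p::finite \<Rightarrow> 's::finite) \<Rightarrow> real ^ 's ^ 'p" where
  "pure q = (\<chi> p. axis (q p) 1)"

definition expected_utility ::
  "('p::finite \<Rightarrow> 's::finite set) \<Rightarrow> (('p \<Rightarrow> 's) \<Rightarrow> real ^ 'p) \<Rightarrow> real ^ 's ^ 'p \<Rightarrow> real ^ 'p" where
  "expected_utility S u x = (\<Sum>q\<in>profiles S. (\<Prod>i\<in>UNIV. x $ i $ q i) *\<^sub>R u q)"

definition deviation_utility ::
  "('p::finite \<Rightarrow> 's::finite set) \<Rightarrow> (('p \<Rightarrow> 's) \<Rightarrow> real ^ 'p) \<Rightarrow> 'p \<Rightarrow> 's \<Rightarrow> real ^ 's ^ 'p \<Rightarrow> real" where
  "deviation_utility S u p s x =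
     expected_utility S u (\<chi> j. if j = p then axis s 1 else x $ j) $ p"

definition replicator_field ::
  "('p::finite \<Rightarrow> 's::finite set) \<Rightarrow> (('p \<Rightarrow> 's) \<Rightarrow> real ^ 'p) \<Rightarrow> real ^ 's ^ 'p \<Rightarrow> real ^ 's ^ 'p" where
  "replicator_field S u x =
     (\<chi> p s. x $ p $ s *
        (deviation_utility S u p s x - (\<Sum>t\<in>S p. x $ p $ t * deviation_utility S u p t x)))"

text \<open>
  The field is polynomial, hence Lipschitz on the compact set \<open>strategy_space S\<close>, so the following
  conditions determine \<open>\<phi> x t\<close> for all \<open>x \<in> strategy_space S\<close> and all real \<open>t\<close>. Continuity and
  the group law follow and are not demanded. Values at other \<open>x\<close> are irrelevant.
\<close>

definition replicator_flow ::
  "('p::finite \<Rightarrow> 's::finite set) \<Rightarrow> (('p \<Rightarrow> 's) \<Rightarrow> real ^ 'p) \<Rightarrow>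
   (real ^ 's ^ 'p \<Rightarrow> real \<Rightarrow> real ^ 's ^ 'p) \<Rightarrow> bool" where
  "replicator_flow S u \<phi> \<longleftrightarrow>
     (\<forall>x\<in>strategy_space S. \<phi> x 0 = x \<and>
        (\<forall>t. \<phi> x t \<in> strategy_space S \<and>
             (\<phi> x has_vector_derivative replicator_field S u (\<phi> x t)) (at t)))"

definition is_chain ::
  "'a::metric_space set \<Rightarrow> ('a \<Rightarrow> real \<Rightarrow> 'a) \<Rightarrow> real \<Rightarrow> real \<Rightarrow> 'a \<Rightarrow> 'a \<Rightarrow>
   nat \<Rightarrow> (nat \<Rightarrow> 'a) \<Rightarrow> (nat \<Rightarrow> real) \<Rightarrow> bool" where
  "is_chain X \<phi> \<epsilon> T x y n z t \<longleftrightarrow>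
     2 \<le> n \<and> z 1 = x \<and> z n = y \<and> (\<forall>i\<in>{1..n}. z i \<in> X) \<and>
     (\<forall>i\<in>{1..n-1}. T \<le> t i \<and> dist (\<phi> (z i) (t i)) (z (i + 1)) < \<epsilon>)"

definition pseudo_orbit ::
  "'a::metric_space set \<Rightarrow> ('a \<Rightarrow> real \<Rightarrow> 'a) \<Rightarrow> 'a \<Rightarrow> 'a \<Rightarrow> bool" where
  "pseudo_orbit X \<phi> x y \<longleftrightarrow> (\<forall>\<epsilon>>0. \<forall>T>0. \<exists>n z t. is_chain X \<phi> \<epsilon> T x y n z t)"

definition chain_equivalent ::
  "'a::metric_space set \<Rightarrow> ('a \<Rightarrow> real \<Rightarrow> 'a) \<Rightarrow> 'a \<Rightarrow> 'a \<Rightarrow> bool" where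
  "chain_equivalent X \<phi> x y \<longleftrightarrow> pseudo_orbit X \<phi> x y \<and> pseudo_orbit X \<phi> y x"

definition chain_recurrent ::
  "'a::metric_space set \<Rightarrow> ('a \<Rightarrow> real \<Rightarrow> 'a) \<Rightarrow> 'a \<Rightarrow> bool" where
  "chain_recurrent X \<phi> x \<longleftrightarrow> chain_equivalent X \<phi> x x"

definition chain_components ::
  "'a::metric_space set \<Rightarrow> ('a \<Rightarrow> real \<Rightarrow> 'a) \<Rightarrow> 'a set set" where
  "chain_components X \<phi> =
     {x. chain_recurrent X \<phi> x} //
     {(x, y). chain_recurrent X \<phi> x \<and> chain_recurrent X \<phi> y \<and> chain_equivalent X \<phi> x y}"

definition sink_chain_component ::
  "'a::metric_space set \<Rightarrow> ('a \<Rightarrow> real \<Rightarrow> 'a) \<Rightarrow> 'a set \<Rightarrow> bool" where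
  "sink_chain_component X \<phi> C \<longleftrightarrow>
     C \<in> chain_components X \<phi> \<and>
     (\<forall>c\<in>C. \<forall>z. chain_recurrent X \<phi> z \<and> pseudo_orbit X \<phi> c z \<longrightarrow> z \<in> C)"

end

theory Submission
  imports Defs
begin

text \<open>
  The heart of the matter is that every \<open>x\<close> has a pseudo-orbit to a pure profile. For fixed \<open>\<epsilon>\<close>
  and \<open>T\<close>, let \<open>w\<close> be a point of least support among those reachable from \<open>x\<close> by
  \<open>(\<epsilon>, T)\<close>-chains. If \<open>w\<close> is not pure, the reachable points in the face of \<open>w\<close> stay away from
  its boundary, and the \<open>\<epsilon>\<close>-neighbourhood of their image under the time-\<open>T\<close> map is reachable again.
  But in log-odds coordinates the replicator field is divergence free: each
  coordinate's velocity is independent of that coordinate. So the time-\<open>T\<close> map preserves volume and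
  cannot contract a bounded nonempty open set strictly into itself. Liouville's theorem is
  avoided: an Euler scheme that updates one coordinate at a time is a composition of
  shears, which preserve volume by Fubini, and the slack \<open>\<epsilon>\<close> absorbs its error.

  Along an arc of the response graph the flow on the edge and small jumps give a pseudo-orbit. A pure
  profile reachable from \<open>x\<close> that is minimal in the pseudo-orbit preorder therefore leads to a sink
  connected component whose chain component is a sink, since whatever leaves it comes back to a
  pure profile, hence by minimality to the component.
\<close>

section \<open>Chains as transitive closures\<close>

definition chain_step ::
  "'a::metric_space set \<Rightarrow> ('a \<Rightarrow> real \<Rightarrow> 'a) \<Rightarrow> real \<Rightarrow> real \<Rightarrow> 'a rel" where
  "chain_step X \<phi> \<epsilon> T = {(a, b). a \<in> X \<and> b \<in> X \<and> (\<exists>t\<ge>T. dist (\<phi> a t) b < \<epsilon>)}"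

lemma chain_stepI:
  "a \<in> X \<Longrightarrow> b \<in> X \<Longrightarrow> T \<le> t \<Longrightarrow> dist (\<phi> a t) b < \<epsilon> \<Longrightarrow> (a, b) \<in> chain_step X \<phi> \<epsilon> T"
  by (auto simp: chain_step_def)

text \<open>The closure is \<open>trancl\<close> rather than \<open>rtrancl\<close> because
  \<open>2 \<le> n\<close> demands at least one jump. Concatenation of chains then becomes
  transitivity.\<close>

lemma ex_chain_iff:
  "(\<exists>n z t. is_chain X \<phi> \<epsilon> T x y n z t) \<longleftrightarrow> (x, y) \<in> (chain_step X \<phi> \<epsilon> T)\<^sup>+"
proof
  assume "\<exists>n z t. is_chain X \<phi> \<epsilon> T x y n z t"
  then obtain n z t where c: "is_chain X \<phi> \<epsilon> T x y n z t" by blast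
  have "(z 1, z (Suc j)) \<in> (chain_step X \<phi> \<epsilon> T)\<^sup>+" if "1 \<le> j" "Suc j \<le> n" for j
    using that
  proof (induction j rule: dec_induct)
    case base
    then show ?case
      using c by (intro r_into_trancl chain_stepI[of _ _ _ _ "t 1"]) (auto simp: is_chain_def)
  next
    case (step j)
    have "(z (Suc j), z (Suc (Suc j))) \<in> chain_step X \<phi> \<epsilon> T"
      using c step by (intro chain_stepI[of _ _ _ _ "t (Suc j)"]) (auto simp: is_chain_def)
    with step show ?case by (auto intro: trancl_into_trancl)
  qed
  from this[of "n - 1"] c show "(x, y) \<in> (chain_step X \<phi> \<epsilon> T)\<^sup>+"
    by (auto simp: is_chain_def)
next
  assume "(x, y) \<in> (chain_step X \<phi> \<epsilon> T)\<^sup>+"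
  then obtain m where m: "m > 0" "(x, y) \<in> chain_step X \<phi> \<epsilon> T ^^ m"
    by (auto simp: trancl_power)
  then obtain f where f: "f 0 = x" "f m = y" "\<And>i. i < m \<Longrightarrow> (f i, f (Suc i)) \<in> chain_step X \<phi> \<epsilon> T"
    by (auto simp: relpow_fun_conv)
  define t where "t i = (SOME t. t \<ge> T \<and> dist (\<phi> (f i) t) (f (Suc i)) < \<epsilon>)" for i
  have t: "t i \<ge> T \<and> dist (\<phi> (f i) (t i)) (f (Suc i)) < \<epsilon>" if "i < m" for i
  proof -
    have "\<exists>t. t \<ge> T \<and> dist (\<phi> (f i) t) (f (Suc i)) < \<epsilon>"
      using f(3)[OF that] by (auto simp: chain_step_def)
    then show ?thesis unfolding t_def by (rule someI_ex)
  qed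
  have X: "f i \<in> X" if "i \<le> m" for i
    using f(3)[of i] f(3)[of "i - 1"] that m(1)
    by (cases "i < m") (auto simp: chain_step_def)
  \<comment> \<open>\<open>relpow_fun_conv\<close> numbers points from 0, chains number them from 1;
    hence the shift by \<open>i - 1\<close>.\<close>
  have "is_chain X \<phi> \<epsilon> T x y (Suc m) (\<lambda>i. f (i - 1)) (\<lambda>i. t (i - 1))"
    unfolding is_chain_def
  proof (intro conjI ballI)
    fix i assume i: "i \<in> {1..Suc m - 1}"
    then show "T \<le> t (i - 1)" "dist (\<phi> (f (i - 1)) (t (i - 1))) (f (i + 1 - 1)) < \<epsilon>"
      using t[of "i - 1"] by auto
  qed (use m f X in auto)
  then show "\<exists>n z t. is_chain X \<phi> \<epsilon> T x y n z t" by blast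
qed

lemma pseudo_orbit_iff:
  "pseudo_orbit X \<phi> x y \<longleftrightarrow> (\<forall>\<epsilon>>0. \<forall>T>0. (x, y) \<in> (chain_step X \<phi> \<epsilon> T)\<^sup>+)"
  by (simp add: pseudo_orbit_def ex_chain_iff)

lemma pseudo_orbit_trans:
  "pseudo_orbit X \<phi> x y \<Longrightarrow> pseudo_orbit X \<phi> y z \<Longrightarrow> pseudo_orbit X \<phi> x z"
  unfolding pseudo_orbit_iff by (meson trancl_trans)

lemma chain_step_mono:
  "\<epsilon> \<le> \<epsilon>' \<Longrightarrow> T' \<le> T \<Longrightarrow> chain_step X \<phi> \<epsilon> T \<subseteq> chain_step X \<phi> \<epsilon>' T'"
  unfolding chain_step_def
proof clarify
  fix a b t
  assume "\<epsilon> \<le> \<epsilon>'" "T' \<le> T" "T \<le> t" "dist (\<phi> a t) b < \<epsilon>"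
  then show "\<exists>t\<ge>T'. dist (\<phi> a t) b < \<epsilon>'" by (intro exI[of _ t]) auto
qed

lemma chain_step_trancl_in:
  "(x, y) \<in> (chain_step X \<phi> \<epsilon> T)\<^sup>+ \<Longrightarrow> x \<in> X \<and> y \<in> X"
  by (induction rule: trancl_induct) (auto simp: chain_step_def)

text \<open>Since there are finitely many targets, one of them serves all \<open>\<epsilon>\<close> and \<open>T\<close>.\<close>

lemma pseudo_orbit_finite_targets:
  assumes "finite A"
    and ex: "\<And>\<epsilon> T. \<epsilon> > 0 \<Longrightarrow> T > 0 \<Longrightarrow> \<exists>a\<in>A. (x, a) \<in> (chain_step X \<phi> \<epsilon> T)\<^sup>+"
  shows "\<exists>a\<in>A. pseudo_orbit X \<phi> x a"
proof (rule ccontr)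
  assume "\<not> ?thesis"
  then obtain e T where eT: "\<And>a. a \<in> A \<Longrightarrow> e a > 0 \<and> T a > 0 \<and> (x, a) \<notin> (chain_step X \<phi> (e a) (T a))\<^sup>+"
    unfolding pseudo_orbit_iff by metis
  \<comment> \<open>The smallest \<open>\<epsilon>\<close> and the largest \<open>T\<close> are at
    least as strict as every failing pair at once. The inserted 1 keeps \<open>Min\<close> and
    \<open>Max\<close> meaningful for empty \<open>A\<close> and makes \<open>T0\<close>
    positive.\<close>
  define e0 where "e0 = Min (insert 1 (e ` A))"
  define T0 where "T0 = Max (insert 1 (T ` A))"
  have "e0 > 0" "T0 > 0"
    using assms(1) eT by (auto simp: e0_def T0_def Max_gr_iff)
  then obtain a where a: "a \<in> A" "(x, a) \<in> (chain_step X \<phi> e0 T0)\<^sup>+" using ex by blast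
  have "chain_step X \<phi> e0 T0 \<subseteq> chain_step X \<phi> (e a) (T a)"
    using a(1) assms(1) by (intro chain_step_mono) (auto simp: e0_def T0_def)
  with a eT show False by (meson trancl_mono)
qed

section \<open>Volume-preserving maps\<close>

definition measure_preserving_on :: "'a measure \<Rightarrow> ('a \<Rightarrow> 'a) \<Rightarrow> bool" where
  "measure_preserving_on M f \<longleftrightarrow> f \<in> measurable M M \<and> distr M M f = M"

lemma measure_preserving_on_comp:
  "measure_preserving_on M f \<Longrightarrow> measure_preserving_on M g \<Longrightarrow> measure_preserving_on M (\<lambda>x. g (f x))"
  unfolding measure_preserving_on_def
  by (auto simp: distr_distr[symmetric, unfolded comp_def])

lemma measure_preserving_on_id: "measure_preserving_on M (\<lambda>x. x)"
  by (simp add: measure_preserving_on_def distr_id)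

abbreviation lborelP :: "'k set \<Rightarrow> ('k \<Rightarrow> real) measure" where
  "lborelP I \<equiv> Pi\<^sub>M I (\<lambda>_. lborel)"

text \<open>Fubini with coordinate \<open>i\<close> innermost: once the other coordinates are fixed,
  \<open>indep\<close> makes \<open>g\<close> constant, and the map is a translation of the
  line.\<close>

lemma measure_preserving_on_shear:
  assumes I: "finite I" "i \<in> I"
    and g [measurable]: "g \<in> borel_measurable (lborelP I)"
    and indep: "\<And>y c. g (y(i := c)) = g y"
  shows "measure_preserving_on (lborelP I) (\<lambda>y. y(i := y i + g y))"
proof -
  interpret product_sigma_finite "\<lambda>_. lborel :: real measure"
    by (simp add: product_sigma_finite_def sigma_finite_lborel)
  obtain J where J: "I = insert i J" "i \<notin> J" "finite J"
    using I by (metis finite_insert mk_disjoint_insert)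
  have [measurable]: "(\<lambda>y. y i) \<in> borel_measurable (lborelP I)"
    using measurable_component_singleton[OF I(2), of "\<lambda>_. lborel"] by simp
  have m: "(\<lambda>y. y(i := y i + g y)) \<in> measurable (lborelP I) (lborelP I)"
    using I(2) by (intro measurable_fun_upd[where J=I]) auto
  have "emeasure (distr (lborelP I) (lborelP I) (\<lambda>y. y(i := y i + g y))) A = emeasure (lborelP I) A"
    if A [measurable]: "A \<in> sets (lborelP I)" for A
  proof -
    have A' [measurable]: "A \<in> sets (lborelP (insert i J))" using A J by simp
    have meas: "(\<lambda>c. x(i := c)) \<in> measurable lborel (lborelP (insert i J))"
      if "x \<in> space (lborelP J)" for x
      using that by (intro measurable_fun_upd[where J=J]) auto
    have "emeasure (distr (lborelP I) (lborelP I) (\<lambda>y. y(i := y i + g y))) A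
        = (\<integral>\<^sup>+y. indicator A y \<partial>distr (lborelP I) (lborelP I) (\<lambda>y. y(i := y i + g y)))"
      by (simp add: nn_integral_indicator)
    also have "\<dots> = (\<integral>\<^sup>+y. indicator A (y(i := y i + g y)) \<partial>lborelP I)"
      using m by (intro nn_integral_distr) simp_all
    also have "\<dots> = (\<integral>\<^sup>+x. \<integral>\<^sup>+c. indicator A (x(i := c + g x)) \<partial>lborel \<partial>lborelP J)"
    proof -
      have "(\<lambda>y. indicator A (y(i := y i + g y)) :: ennreal) \<in> borel_measurable (lborelP (insert i J))"
        using measurable_compose[OF m, of "indicator A" borel] J(1) A by simp
      then show ?thesis
        unfolding J(1) by (simp add: product_nn_integral_insert[OF J(3,2)] indep)
    qed
    also have "\<dots> = (\<integral>\<^sup>+x. \<integral>\<^sup>+c. indicator A (x(i := c)) \<partial>lborel \<partial>lborelP J)"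
    proof (rule nn_integral_cong)
      fix x assume x: "x \<in> space (lborelP J)"
      have b: "(\<lambda>c. indicator A (x(i := c)) :: ennreal) \<in> borel_measurable borel"
        using measurable_compose[OF meas[OF x], of "indicator A" borel] A' by simp
      have "(\<integral>\<^sup>+c. indicator A (x(i := c)) \<partial>lborel)
          = (\<integral>\<^sup>+c. indicator A (x(i := c)) \<partial>distr lborel borel ((+) (g x)))"
        by (simp add: lborel_distr_plus)
      also have "\<dots> = (\<integral>\<^sup>+c. indicator A (x(i := g x + c)) \<partial>lborel)"
        using b by (subst nn_integral_distr) auto
      finally show "(\<integral>\<^sup>+c. indicator A (x(i := c + g x)) \<partial>lborel)
          = (\<integral>\<^sup>+c. indicator A (x(i := c)) \<partial>lborel)" by (simp add: add.commute)
    qed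
    also have "\<dots> = (\<integral>\<^sup>+y. indicator A y \<partial>lborelP I)"
      unfolding J(1) by (subst product_nn_integral_insert[OF J(3,2)]) auto
    finally show ?thesis using A by simp
  qed
  then show ?thesis using m by (auto simp: measure_preserving_on_def intro!: measure_eqI)
qed

lemma emeasure_absorbed_Int_vimage:
  assumes G: "measure_preserving_on M G"
    and R: "R \<in> sets M" "emeasure M R < \<infinity>" "\<And>y. y \<in> R \<Longrightarrow> G y \<in> R"
    and B: "B \<in> sets M"
  shows "emeasure M (R \<inter> B) = emeasure M (R \<inter> G -` B)"
proof -
  have Gm: "G \<in> measurable M M" and Gd: "distr M M G = M"
    using G by (auto simp: measure_preserving_on_def)
  have pre: "emeasure M (G -` A \<inter> space M) = emeasure M A" if "A \<in> sets M" for A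
    using emeasure_distr[OF Gm that] Gd by simp
  have sub: "R \<subseteq> G -` R \<inter> space M" using R sets.sets_into_space by blast
  have sets: "G -` A \<inter> space M \<in> sets M" if "A \<in> sets M" for A
    using Gm that by (rule measurable_sets)
  have "emeasure M ((G -` R \<inter> space M) - R) = 0"
    using emeasure_Diff[of M R "G -` R \<inter> space M"] R sub sets pre[OF R(1)]
    by (simp add: less_top[symmetric])
  then have null: "(G -` R \<inter> space M) - R \<in> null_sets M" using sets R by auto
  have "emeasure M (R \<inter> B) = emeasure M (G -` (R \<inter> B) \<inter> space M)"
    using pre[of "R \<inter> B"] R(1) B by (simp add: sets.Int)
  also have "G -` (R \<inter> B) \<inter> space M
      = (R \<inter> (G -` B \<inter> space M)) \<union> (((G -` R \<inter> space M) - R) \<inter> (G -` B \<inter> space M))"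
    using sub by auto
  also have "emeasure M \<dots> = emeasure M (R \<inter> (G -` B \<inter> space M))"
    using null R B sets by (intro emeasure_Un_null_set) (auto intro: sets.Int null_set_Int2)
  also have "R \<inter> (G -` B \<inter> space M) = R \<inter> G -` B" using sub by auto
  finally show ?thesis .
qed

text \<open>
  If a measure-preserving map and all its small translates map \<open>R\<close> into itself, then the amount of
  \<open>R\<close> above level \<open>a\<close> is the same as that above level \<open>a - c\<close>; boundedness makes it vanish.
\<close>

lemma emeasure_absorbing_eq_0:
  assumes I: "finite I" "k \<in> I"
    and \<Psi>: "measure_preserving_on (lborelP I) \<Psi>"
    and R: "R \<in> sets (lborelP I)" and bnd: "\<And>y j. y \<in> R \<Longrightarrow> j \<in> I \<Longrightarrow> \<bar>y j\<bar> \<le> K"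
    and c: "c > 0"
    and into: "\<And>y. y \<in> R \<Longrightarrow> \<Psi> y \<in> R"
    and into_shift: "\<And>y. y \<in> R \<Longrightarrow> (\<Psi> y)(k := \<Psi> y k + c) \<in> R"
  shows "emeasure (lborelP I) R = 0"
proof -
  interpret product_sigma_finite "\<lambda>_. lborel :: real measure"
    by (simp add: product_sigma_finite_def sigma_finite_lborel)
  let ?M = "lborelP I"
  have k [measurable]: "(\<lambda>y. y k) \<in> borel_measurable ?M"
    using measurable_component_singleton[OF I(2), of "\<lambda>_. lborel"] by simp
  have space: "R \<subseteq> space ?M" using R sets.sets_into_space by blast
  have "R \<subseteq> Pi\<^sub>E I (\<lambda>_. {-K..K})"
  proof
    fix y assume y: "y \<in> R"
    have "y \<in> extensional I" using space y by (auto simp: space_PiM PiE_def)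
    moreover have "y j \<in> {-K..K}" if "j \<in> I" for j
      using bnd[OF y that] by auto
    ultimately show "y \<in> Pi\<^sub>E I (\<lambda>_. {-K..K})" by (auto simp: PiE_iff)
  qed
  then have "emeasure ?M R \<le> emeasure ?M (Pi\<^sub>E I (\<lambda>_. {-K..K}))"
    using I by (intro emeasure_mono sets_PiM_I_finite) auto
  also have "\<dots> = (\<Prod>j\<in>I. emeasure lborel {-K..K})" using I by (intro emeasure_PiM) auto
  also have "\<dots> < \<infinity>"
    using emeasure_lborel_Icc_eq[of "- K" K]
    by (auto simp: less_top[symmetric] ennreal_prod_eq_top simp del: prod_constant)
  finally have fin: "emeasure ?M R < \<infinity>" .
  have shift: "measure_preserving_on ?M (\<lambda>y. (\<Psi> y)(k := \<Psi> y k + c))"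
    using measure_preserving_on_comp[OF \<Psi> measure_preserving_on_shear[OF I, of "\<lambda>_. c"]] by simp
  define h where "h a = emeasure ?M (R \<inter> {y \<in> space ?M. y k > a})" for a
  have B: "{y \<in> space ?M. y k > a} \<in> sets ?M" for a by measurable
  have maps: "\<Psi> y \<in> space ?M" "(\<Psi> y)(k := \<Psi> y k + c) \<in> space ?M" if "y \<in> R" for y
    using into into_shift space that by blast+
  \<comment> \<open>Inside \<open>R\<close>, lying above \<open>a - c\<close> after
    \<open>\<Psi>\<close> is the same as lying above \<open>a\<close> after the shifted map.
    Absorption for both maps turns this into equal measures.\<close>
  have h1: "h a = h (a - c)" for a
  proof -
    have "h (a - c) = emeasure ?M (R \<inter> \<Psi> -` {y \<in> space ?M. y k > a - c})"
      unfolding h_def using emeasure_absorbed_Int_vimage[OF \<Psi> R fin into B] .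
    also have "R \<inter> \<Psi> -` {y \<in> space ?M. y k > a - c}
        = R \<inter> (\<lambda>y. (\<Psi> y)(k := \<Psi> y k + c)) -` {y \<in> space ?M. y k > a}"
      using maps by auto
    also have "emeasure ?M \<dots> = h a"
      unfolding h_def using emeasure_absorbed_Int_vimage[OF shift R fin into_shift B] by simp
    finally show ?thesis by simp
  qed
  have h2: "h a = h (a - real n * c)" for a n
  proof (induction n)
    case (Suc n)
    then show ?case using h1[of "a - real n * c"] by (simp add: algebra_simps)
  qed simp
  \<comment> \<open>After \<open>n\<close> steps the level has moved from \<open>K\<close>, above
    which \<open>R\<close> has no points, to below \<open>- K\<close>, above which lies all of
    \<open>R\<close>.\<close>
  obtain n where n: "K - real n * c < - K"
    using reals_Archimedean3[OF c, rule_format, of "2 * K"] by auto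
  have le: "y k \<le> K" "y k > K - real n * c" if "y \<in> R" for y
    using bnd[OF that I(2)] n by auto
  have "R \<inter> {y \<in> space ?M. y k > K} = {}" using le(1) by force
  then have "h K = 0" by (simp add: h_def)
  moreover have "R \<inter> {y \<in> space ?M. y k > K - real n * c} = R" using space le(2) by auto
  then have "h (K - real n * c) = emeasure ?M R" by (simp add: h_def)
  ultimately show ?thesis using h2[of K n] by simp
qed

lemma emeasure_PiE_box_pos:
  assumes "finite I" "\<delta> > 0"
  shows "emeasure (lborelP I) (Pi\<^sub>E I (\<lambda>k. {y k - \<delta> .. y k + \<delta>})) > 0"
proof -
  interpret product_sigma_finite "\<lambda>_. lborel :: real measure"
    by (simp add: product_sigma_finite_def sigma_finite_lborel)
  have "emeasure (lborelP I) (Pi\<^sub>E I (\<lambda>k. {y k - \<delta> .. y k + \<delta>})) = (\<Prod>k\<in>I. ennreal (2 * \<delta>))"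
    using assms by (subst emeasure_PiM) (auto intro!: prod.cong)
  also have "\<dots> > 0" using assms by (simp add: prod_constant ennreal_power)
  finally show ?thesis .
qed

section \<open>Divergence-free fields\<close>

text \<open>\<open>indep\<close> is a strong form of zero divergence: every diagonal partial
  derivative vanishes. It makes the update of a single coordinate a shear. With
  \<open>\<delta> = 0\<close>, \<open>lipschitz\<close> says that \<open>F k\<close> depends only on
  coordinates in \<open>I\<close>.\<close>

locale solenoidal_field =
  fixes I :: "'k set" and F :: "'k \<Rightarrow> ('k \<Rightarrow> real) \<Rightarrow> real" and M L :: real
  assumes finite_I: "finite I"
    and bound: "k \<in> I \<Longrightarrow> \<bar>F k y\<bar> \<le> M"
    and lipschitz: "k \<in> I \<Longrightarrow> (\<And>j. j \<in> I \<Longrightarrow> \<bar>y j - y' j\<bar> \<le> \<delta>) \<Longrightarrow> \<bar>F k y - F k y'\<bar> \<le> L * \<delta>"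
    and indep: "k \<in> I \<Longrightarrow> F k (y(k := c)) = F k y"
    and measurable_F: "k \<in> I \<Longrightarrow> F k \<in> borel_measurable (lborelP I)"
    and M_nonneg: "0 \<le> M" and L_nonneg: "0 \<le> L"
begin

definition solution :: "(real \<Rightarrow> 'k \<Rightarrow> real) \<Rightarrow> bool" where
  "solution Y \<longleftrightarrow> (\<forall>k\<in>I. \<forall>t\<ge>0. ((\<lambda>t. Y t k) has_real_derivative F k (Y t)) (at t))"

text \<open>An Euler step of size \<open>h\<close> in which each coordinate already sees the earlier
  updates. A simultaneous Euler step would not be a composition of shears.\<close>

definition sweep :: "real \<Rightarrow> 'k list \<Rightarrow> ('k \<Rightarrow> real) \<Rightarrow> 'k \<Rightarrow> real" where
  "sweep h = fold (\<lambda>k y. y(k := y k + h * F k y))"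

lemma sweep_simps [simp]:
  "sweep h [] y = y" "sweep h (k # ks) y = sweep h ks (y(k := y k + h * F k y))"
  by (simp_all add: sweep_def)

lemma measure_preserving_sweep:
  assumes "set ks \<subseteq> I"
  shows "measure_preserving_on (lborelP I) (sweep h ks)"
  using assms
proof (induction ks)
  case Nil
  then show ?case using measure_preserving_on_id by simp
next
  case (Cons k ks)
  then have k: "k \<in> I" by simp
  have "(\<lambda>y. h * F k y) \<in> borel_measurable (lborelP I)"
    using measurable_F[OF k] by simp
  then have "measure_preserving_on (lborelP I) (\<lambda>y. y(k := y k + h * F k y))"
    by (intro measure_preserving_on_shear[OF finite_I k]) (simp_all add: indep[OF k])
  moreover have "sweep h (k # ks) = (\<lambda>y. sweep h ks (y(k := y k + h * F k y)))"
    by (rule ext) simp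
  moreover have "measure_preserving_on (lborelP I) (sweep h ks)"
    using Cons by simp
  ultimately show ?case
    using measure_preserving_on_comp by (simp del: fun_upd_apply)
qed

text \<open>The witness \<open>y'\<close> is the state just before \<open>k\<close> is updated. Each
  coordinate has by then moved at most once, by at most \<open>h * M\<close>. Induction from the
  right isolates the last update.\<close>

lemma sweep_coordinate:
  assumes "distinct ks" "set ks \<subseteq> I" "h \<ge> 0"
  shows "(\<forall>j. j \<notin> set ks \<longrightarrow> sweep h ks y j = y j) \<and>
    (\<forall>k\<in>set ks. \<exists>y'. (\<forall>j\<in>I. \<bar>y' j - y j\<bar> \<le> h * M) \<and> sweep h ks y k = y k + h * F k y')"
  using assms
proof (induction ks rule: rev_induct)
  case (snoc k ks)
  let ?y = "sweep h ks y"
  have hM: "0 \<le> h * M" using snoc.prems M_nonneg by simp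
  have eq: "sweep h (ks @ [k]) y = ?y(k := ?y k + h * F k ?y)" by (simp add: sweep_def)
  have IH: "\<And>j. j \<notin> set ks \<Longrightarrow> ?y j = y j"
    "\<And>k. k \<in> set ks \<Longrightarrow> \<exists>y'. (\<forall>j\<in>I. \<bar>y' j - y j\<bar> \<le> h * M) \<and> ?y k = y k + h * F k y'"
    using snoc by auto
  have "\<bar>?y j - y j\<bar> \<le> h * M" if "j \<in> I" for j
  proof (cases "j \<in> set ks")
    case True
    then obtain y' where "?y j = y j + h * F j y'" using IH(2) by blast
    then show ?thesis using bound[OF that, of y'] snoc.prems
      by (simp add: abs_mult mult_left_mono)
  qed (use IH hM in auto)
  moreover have "?y k = y k" using IH(1) snoc.prems by auto
  ultimately have "\<exists>y'. (\<forall>j\<in>I. \<bar>y' j - y j\<bar> \<le> h * M) \<and> ?y k + h * F k ?y = y k + h * F k y'"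
    by (intro exI[of _ ?y]) auto
  then show ?case using IH snoc.prems unfolding eq by auto
qed simp

text \<open>Mean value theorem for a single coordinate; the time \<open>\<xi>\<close> may differ
  from one \<open>k\<close> to another.\<close>

lemma solution_drift:
  assumes Y: "solution Y" and k: "k \<in> I" and "0 \<le> s" "s \<le> t"
  shows "\<bar>Y t k - Y s k\<bar> \<le> (t - s) * M"
    and "\<exists>\<xi>. s \<le> \<xi> \<and> \<xi> \<le> t \<and> Y t k - Y s k = (t - s) * F k (Y \<xi>)"
proof -
  show ex: "\<exists>\<xi>. s \<le> \<xi> \<and> \<xi> \<le> t \<and> Y t k - Y s k = (t - s) * F k (Y \<xi>)"
  proof (cases "s = t")
    case False
    then have "s < t" using assms by simp
    moreover have "\<And>x. s \<le> x \<Longrightarrow> x \<le> t \<Longrightarrow> ((\<lambda>t. Y t k) has_real_derivative F k (Y x)) (at x)"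
      using Y k assms(3) by (simp add: solution_def)
    ultimately obtain \<xi> where "s < \<xi>" "\<xi> < t" "Y t k - Y s k = (t - s) * F k (Y \<xi>)"
      using MVT2[of s t "\<lambda>t. Y t k" "\<lambda>x. F k (Y x)"] by blast
    then show ?thesis by (intro exI[of _ \<xi>]) auto
  qed auto
  then show "\<bar>Y t k - Y s k\<bar> \<le> (t - s) * M"
    using bound[OF k] assms by (auto simp: abs_mult intro!: mult_left_mono)
qed

text \<open>The increments of solution and sweep are \<open>h\<close> times the field at two points
  whose coordinates differ by at most \<open>2 * (h * M) + e\<close>: each point strays by
  \<open>h * M\<close> from its start, and the starts differ by \<open>e\<close>.\<close>

lemma sweep_local_error:
  assumes Y: "solution Y" and ks: "distinct ks" "set ks = I" and h: "h \<ge> 0" and t: "t \<ge> 0"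
    and e: "\<And>j. j \<in> I \<Longrightarrow> \<bar>Y t j - y j\<bar> \<le> e" and k: "k \<in> I"
  shows "\<bar>Y (t + h) k - sweep h ks y k\<bar> \<le> e * (1 + h * L) + 2 * L * M * h\<^sup>2"
proof -
  obtain \<xi> where \<xi>: "t \<le> \<xi>" "\<xi> \<le> t + h" "Y (t + h) k - Y t k = h * F k (Y \<xi>)"
    using solution_drift(2)[OF Y k t, of "t + h"] h by auto
  obtain y' where y': "\<And>j. j \<in> I \<Longrightarrow> \<bar>y' j - y j\<bar> \<le> h * M" "sweep h ks y k = y k + h * F k y'"
    using sweep_coordinate[OF ks(1) _ h, of y] ks(2) k by blast
  have "\<bar>Y \<xi> j - y' j\<bar> \<le> 2 * (h * M) + e" if j: "j \<in> I" for j
  proof -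
    have "\<bar>Y \<xi> j - Y t j\<bar> \<le> (\<xi> - t) * M" using solution_drift(1)[OF Y j t \<xi>(1)] .
    also have "\<dots> \<le> h * M" using \<xi> M_nonneg by (intro mult_right_mono) auto
    finally show ?thesis using y'(1)[OF j] e[OF j] by linarith
  qed
  then have "\<bar>F k (Y \<xi>) - F k y'\<bar> \<le> L * (2 * (h * M) + e)" by (rule lipschitz[OF k])
  then have "\<bar>h * (F k (Y \<xi>) - F k y')\<bar> \<le> h * (L * (2 * (h * M) + e))"
    using h by (simp add: abs_mult mult_left_mono)
  moreover have "Y (t + h) k - sweep h ks y k = (Y t k - y k) + h * (F k (Y \<xi>) - F k y')"
    using \<xi>(3) y'(2) by (simp add: algebra_simps)
  ultimately have "\<bar>Y (t + h) k - sweep h ks y k\<bar> \<le> e + h * (L * (2 * (h * M) + e))"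
    using e[OF k] by linarith
  then show ?thesis by (simp add: algebra_simps power2_eq_square)
qed

text \<open>A discrete Gronwall estimate. Each step multiplies the old error by
  \<open>1 + h * L\<close> and adds a term quadratic in \<open>h\<close>; giving every added term
  the full power is crude but closes the induction.\<close>

lemma sweep_global_error:
  assumes Y: "solution Y" and ks: "distinct ks" "set ks = I" and h: "h \<ge> 0"
    and Y0: "\<And>j. j \<in> I \<Longrightarrow> Y 0 j = y j" and k: "k \<in> I"
  shows "\<bar>Y (real n * h) k - (sweep h ks ^^ n) y k\<bar> \<le> real n * (2 * L * M * h\<^sup>2) * (1 + h * L) ^ n"
  using k
proof (induction n arbitrary: k)
  case 0
  then show ?case using Y0 by simp
next
  case (Suc n)
  let ?C = "2 * L * M * h\<^sup>2" and ?q = "1 + h * L"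
  have q: "?q \<ge> 1" and C: "?C \<ge> 0" using h L_nonneg M_nonneg by auto
  have "\<bar>Y (real n * h + h) k - sweep h ks ((sweep h ks ^^ n) y) k\<bar> \<le> real n * ?C * ?q ^ n * ?q + ?C"
    using Suc.IH h by (intro sweep_local_error[OF Y ks h _ _ Suc.prems]) auto
  also have "\<dots> \<le> real n * ?C * ?q ^ Suc n + ?C * ?q ^ Suc n"
    using mult_left_mono[OF one_le_power[OF q, of "Suc n"] C] by (simp add: algebra_simps)
  finally show ?case by (simp add: algebra_simps)
qed

lemma measure_preserving_approximation:
  assumes T: "T > 0" and \<delta>: "\<delta> > 0"
  obtains \<Psi> where "measure_preserving_on (lborelP I) \<Psi>"
    "\<And>Y y k. solution Y \<Longrightarrow> (\<And>j. j \<in> I \<Longrightarrow> Y 0 j = y j) \<Longrightarrow> k \<in> I \<Longrightarrow> \<bar>Y T k - \<Psi> y k\<bar> \<le> \<delta>"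
proof -
  obtain ks where ks: "distinct ks" "set ks = I"
    using finite_distinct_list[OF finite_I] by blast
  \<comment> \<open>With \<open>h = T / real n\<close> the global error is at most
    \<open>?C / real n\<close>, since \<open>(1 + h * L) ^ n\<close> stays below
    \<open>exp (T * L)\<close>.\<close>
  let ?C = "2 * L * M * T\<^sup>2 * exp (T * L)"
  obtain n :: nat where n: "?C < real n * \<delta>"
    using reals_Archimedean3[OF \<delta>] by blast
  have C: "0 \<le> ?C" using L_nonneg M_nonneg by auto
  then have n0: "n > 0" using n by (cases n) auto
  define h where "h = T / real n"
  have h: "h \<ge> 0" "real n * h = T" using T n0 by (auto simp: h_def)
  have "measure_preserving_on (lborelP I) (sweep h ks ^^ m)" for m
  proof (induction m)
    case (Suc m)
    from measure_preserving_on_comp[OF Suc measure_preserving_sweep[of ks h]] ks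
    show ?case by (simp add: comp_def)
  qed (simp add: id_def measure_preserving_on_id)
  moreover have "\<bar>Y T k - (sweep h ks ^^ n) y k\<bar> \<le> \<delta>"
    if Y: "solution Y" "\<And>j. j \<in> I \<Longrightarrow> Y 0 j = y j" "k \<in> I" for Y y k
  proof -
    have "\<bar>Y T k - (sweep h ks ^^ n) y k\<bar> \<le> real n * (2 * L * M * h\<^sup>2) * (1 + h * L) ^ n"
      using sweep_global_error[OF Y(1) ks h(1) Y(2,3), of n] h by simp
    also have "\<dots> \<le> real n * (2 * L * M * h\<^sup>2) * exp (T * L)"
    proof -
      have "(1 + h * L) ^ n \<le> exp (h * L) ^ n"
        using h L_nonneg by (intro power_mono exp_ge_add_one_self) auto
      also have "\<dots> = exp (T * L)"
        using h(2) by (simp add: exp_of_nat_mult[symmetric] mult.assoc[symmetric])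
      finally show ?thesis using L_nonneg M_nonneg by (intro mult_left_mono) auto
    qed
    also have "\<dots> = ?C / real n" using n0 by (simp add: h_def field_simps power2_eq_square)
    also have "\<dots> \<le> \<delta>" using n n0 by (simp add: field_simps)
    finally show ?thesis .
  qed
  ultimately show ?thesis by (rule that)
qed

end

section \<open>The replicator flow\<close>

definition support :: "real ^ 's ^ 'p \<Rightarrow> ('p \<times> 's) set" where
  "support x = {(p, s). x $ p $ s \<noteq> 0}"

lemma norm_vec_vec_le:
  fixes z :: "real ^ 's::finite ^ 'p::finite"
  assumes "\<And>p s. \<bar>z $ p $ s\<bar> \<le> c"
  shows "norm z \<le> real (CARD('p) * CARD('s)) * c"
proof -
  have "norm (z $ p) \<le> real CARD('s) * c" for p
  proof -
    have "norm (z $ p) \<le> (\<Sum>s\<in>UNIV. \<bar>z $ p $ s\<bar>)" by (rule norm_le_l1_cart)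
    also have "\<dots> \<le> real CARD('s) * c" using assms by (intro sum_bounded_above)
    finally show ?thesis .
  qed
  then have "(\<Sum>p\<in>UNIV. norm (z $ p)) \<le> real CARD('p) * (real CARD('s) * c)"
    using sum_bounded_above[of UNIV "\<lambda>p. norm (z $ p)"] by simp
  moreover have "norm z \<le> (\<Sum>p\<in>UNIV. norm (z $ p))"
    unfolding norm_vec_def by (rule L2_set_le_sum) simp
  ultimately show ?thesis by (simp add: mult.assoc)
qed

lemma strategy_spaceD:
  assumes "x \<in> strategy_space S"
  shows "0 \<le> x $ p $ s" "x $ p $ s \<le> 1" "s \<notin> S p \<Longrightarrow> x $ p $ s = 0" "(\<Sum>s\<in>S p. x $ p $ s) = 1"
proof -
  show 0: "0 \<le> x $ p $ s" and "s \<notin> S p \<Longrightarrow> x $ p $ s = 0" and 1: "(\<Sum>s\<in>S p. x $ p $ s) = 1" for s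
    using assms by (auto simp: strategy_space_def)
  show "x $ p $ s \<le> 1"
  proof (cases "s \<in> S p")
    case True
    then have "x $ p $ s \<le> (\<Sum>s\<in>S p. x $ p $ s)"
      using 0 by (intro member_le_sum) auto
    then show ?thesis using 1 by simp
  qed (use assms in \<open>auto simp: strategy_space_def\<close>)
qed

section \<open>Bounds and Lipschitz estimates for deviation payoffs\<close>

lemma deviation_utility_eq:
  "deviation_utility S u p s x =
     (\<Sum>q\<in>profiles S. (\<Prod>j\<in>UNIV. if j = p then (if q p = s then 1 else 0) else x $ j $ q j) * u q $ p)"
  unfolding deviation_utility_def expected_utility_def
  by (simp add: sum_component axis_def if_distrib[of "\<lambda>v. v $ _"] cong: if_cong)

definition total_utility :: "('p::finite \<Rightarrow> 's::finite set) \<Rightarrow> (('p \<Rightarrow> 's) \<Rightarrow> real ^ 'p) \<Rightarrow> real" where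
  "total_utility S u = (\<Sum>q\<in>profiles S. norm (u q))"

lemma total_utility_nonneg: "0 \<le> total_utility S u"
  by (simp add: total_utility_def sum_nonneg)

lemma abs_deviation_utility_le:
  assumes "x \<in> strategy_space S"
  shows "\<bar>deviation_utility S u p s x\<bar> \<le> total_utility S u"
proof -
  have "\<bar>(\<Prod>j\<in>UNIV. if j = p then (if q p = s then 1 else 0) else x $ j $ q j) * u q $ p\<bar> \<le> norm (u q)" for q
  proof -
    have "\<bar>\<Prod>j\<in>UNIV. if j = p then (if q p = s then 1 else 0) else x $ j $ q j\<bar> \<le> 1"
      unfolding abs_prod using strategy_spaceD[OF assms] by (intro prod_le_1) auto
    then have "\<bar>\<Prod>j\<in>UNIV. if j = p then (if q p = s then 1 else 0) else x $ j $ q j\<bar> * \<bar>u q $ p\<bar> \<le> 1 * norm (u q)"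
      by (intro mult_mono component_le_norm_cart) auto
    then show ?thesis by (simp add: abs_mult)
  qed
  then show ?thesis
    unfolding deviation_utility_eq total_utility_def
    by (intro order_trans[OF sum_abs] sum_mono)
qed

text \<open>A product of factors of modulus at most 1 changes by no more than the sum of the changes
  of its factors, one for each player.\<close>

lemma deviation_utility_lipschitz:
  fixes x y :: "real ^ 's::finite ^ 'p::finite"
  assumes x: "x \<in> strategy_space S" and y: "y \<in> strategy_space S"
    and c: "\<And>p s. \<bar>x $ p $ s - y $ p $ s\<bar> \<le> c"
  shows "\<bar>deviation_utility S u p s x - deviation_utility S u p s y\<bar> \<le> total_utility S u * (real CARD('p) * c)"
proof -
  have c0: "0 \<le> c" using c[of undefined undefined] by linarith
  let ?P = "\<lambda>x q. \<Prod>j\<in>UNIV. if j = p then (if q p = s then 1 else 0) else x $ j $ q j"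
  have "\<bar>?P x q * u q $ p - ?P y q * u q $ p\<bar> \<le> norm (u q) * (real CARD('p) * c)" for q
  proof -
    have "\<bar>?P x q - ?P y q\<bar> \<le> (\<Sum>j\<in>UNIV. \<bar>(if j = p then (if q p = s then 1 else 0) else x $ j $ q j)
        - (if j = p then (if q p = s then 1 else 0) else y $ j $ q j)\<bar>)"
      using strategy_spaceD[OF x] strategy_spaceD[OF y]
      unfolding real_norm_def[symmetric] by (intro norm_prod_diff) auto
    also have "\<dots> \<le> (\<Sum>j\<in>(UNIV::'p set). c)" using c c0 by (intro sum_mono) auto
    finally have "\<bar>?P x q - ?P y q\<bar> * \<bar>u q $ p\<bar> \<le> (real CARD('p) * c) * norm (u q)"
      by (intro mult_mono component_le_norm_cart) (auto simp: c0)
    then show ?thesis by (simp add: abs_mult[symmetric] algebra_simps)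
  qed
  then show ?thesis
    unfolding deviation_utility_eq total_utility_def sum_subtractf[symmetric] sum_distrib_right
    by (intro order_trans[OF sum_abs] sum_mono)
qed

text \<open>This is the source of the vanishing divergence in log-odds coordinates.\<close>

lemma deviation_utility_cong:
  "(\<And>j. j \<noteq> p \<Longrightarrow> x $ j = y $ j) \<Longrightarrow> deviation_utility S u p s x = deviation_utility S u p s y"
  unfolding deviation_utility_eq
  by (intro sum.cong refl arg_cong2[where f="(*)"] prod.cong) auto

lemma deviation_utility_pure:
  assumes "\<And>j. j \<noteq> p \<Longrightarrow> x $ j = axis (a j) 1" and a: "a(p := s) \<in> profiles S"
  shows "deviation_utility S u p s x = u (a(p := s)) $ p"
proof -
  have "(\<Prod>j\<in>UNIV. if j = p then (if q p = s then 1 else 0) else x $ j $ q j) = (if q = a(p := s) then 1 else (0::real))"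
    for q
  proof (cases "q = a(p := s)")
    case False
    then obtain j where "q j \<noteq> (a(p := s)) j" by blast
    then have "(if j = p then (if q p = s then 1 else 0) else x $ j $ q j) = 0"
      using assms(1)[of j] by (auto simp: axis_def split: if_splits)
    then have "(\<Prod>j\<in>UNIV. if j = p then (if q p = s then 1 else 0) else x $ j $ q j) = 0"
      by (intro prod_zero[OF finite] bexI[of _ j] UNIV_I)
    then show ?thesis using False by simp
  qed (auto intro!: prod.neutral simp: assms(1))
  then show ?thesis unfolding deviation_utility_eq using a by (simp add: if_distrib[of "\<lambda>v. v * _"] cong: if_cong)
qed

text \<open>The logarithmic derivative of \<open>x $ p $ s\<close> along the flow.\<close>

definition growth ::
  "('p::finite \<Rightarrow> 's::finite set) \<Rightarrow> (('p \<Rightarrow> 's) \<Rightarrow> real ^ 'p) \<Rightarrow> 'p \<Rightarrow> 's \<Rightarrow> real ^ 's ^ 'p \<Rightarrow> real" where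
  "growth S u p s x =
     deviation_utility S u p s x - (\<Sum>t\<in>S p. x $ p $ t * deviation_utility S u p t x)"

lemma abs_growth_le:
  assumes x: "x \<in> strategy_space S"
  shows "\<bar>growth S u p s x\<bar> \<le> 2 * total_utility S u"
proof -
  have "\<bar>\<Sum>t\<in>S p. x $ p $ t * deviation_utility S u p t x\<bar> \<le> (\<Sum>t\<in>S p. x $ p $ t * total_utility S u)"
    using abs_deviation_utility_le[OF x] strategy_spaceD(1)[OF x]
    by (intro order_trans[OF sum_abs] sum_mono) (auto simp: abs_mult intro!: mult_left_mono)
  also have "\<dots> = total_utility S u"
    using strategy_spaceD(4)[OF x] by (simp add: sum_distrib_right[symmetric])
  finally show ?thesis
    using abs_deviation_utility_le[OF x, of u p s] unfolding growth_def by linarith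
qed

section \<open>Invariance of supports under the flow\<close>

lemma flow_facts:
  assumes "replicator_flow S u \<phi>" "x \<in> strategy_space S"
  shows "\<phi> x 0 = x" "\<phi> x t \<in> strategy_space S"
    "((\<lambda>t. \<phi> x t $ p $ s) has_real_derivative \<phi> x t $ p $ s * growth S u p s (\<phi> x t)) (at t)"
proof -
  show "\<phi> x 0 = x" "\<phi> x t \<in> strategy_space S" using assms by (auto simp: replicator_flow_def)
  have "(\<phi> x has_vector_derivative replicator_field S u (\<phi> x t)) (at t)"
    using assms by (auto simp: replicator_flow_def)
  then have "((\<lambda>t. \<phi> x t $ p $ s) has_vector_derivative replicator_field S u (\<phi> x t) $ p $ s) (at t)"
    by (intro bounded_linear.has_vector_derivative[OF bounded_linear_vec_nth])
  then show "((\<lambda>t. \<phi> x t $ p $ s) has_real_derivative \<phi> x t $ p $ s * growth S u p s (\<phi> x t)) (at t)"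
    by (simp add: has_real_derivative_iff_has_vector_derivative replicator_field_def growth_def)
qed

text \<open>The integrating factors \<open>exp (M * t)\<close> and \<open>exp (- M * t)\<close> make
  \<open>f\<close> nondecreasing and nonincreasing, respectively. No division by \<open>f\<close>
  occurs, so zeros are allowed: the two bounds keep positive coordinates positive and zero
  coordinates zero.\<close>

lemma exponential_growth_bounds:
  fixes f :: "real \<Rightarrow> real"
  assumes der: "\<And>t. 0 \<le> t \<Longrightarrow> (f has_real_derivative f t * g t) (at t)"
    and f: "\<And>t. 0 \<le> f t" and g: "\<And>t. \<bar>g t\<bar> \<le> M" and t: "0 \<le> t"
  shows "f 0 * exp (- M * t) \<le> f t" "f t \<le> f 0 * exp (M * t)"
proof -
  have "f 0 * exp (M * 0) \<le> f t * exp (M * t)"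
  proof (rule DERIV_nonneg_imp_nondecreasing[OF t])
    fix s assume s: "0 \<le> s" "s \<le> t"
    have "((\<lambda>t. f t * exp (M * t)) has_real_derivative f s * exp (M * s) * (g s + M)) (at s)"
      by (rule derivative_eq_intros der s refl | simp add: algebra_simps)+
    moreover have "0 \<le> g s + M" using g[of s] by linarith
    ultimately show "\<exists>y. ((\<lambda>t. f t * exp (M * t)) has_real_derivative y) (at s) \<and> 0 \<le> y"
      using f[of s] by (metis exp_ge_zero mult_nonneg_nonneg)
  qed
  then have "f 0 * exp (- M * t) \<le> f t * exp (M * t) * exp (- M * t)"
    by (intro mult_right_mono) auto
  then show "f 0 * exp (- M * t) \<le> f t" by (simp add: mult.assoc exp_add[symmetric])
  have "f t * exp (- M * t) \<le> f 0 * exp (- M * 0)"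
  proof (rule DERIV_nonpos_imp_nonincreasing[OF t])
    fix s assume s: "0 \<le> s" "s \<le> t"
    have "((\<lambda>t. f t * exp (- M * t)) has_real_derivative f s * exp (- M * s) * (g s - M)) (at s)"
      by (rule derivative_eq_intros der s refl | simp add: algebra_simps)+
    moreover have "g s - M \<le> 0" using g[of s] by linarith
    ultimately show "\<exists>y. ((\<lambda>t. f t * exp (- M * t)) has_real_derivative y) (at s) \<and> y \<le> 0"
      using f[of s] by (metis exp_ge_zero mult_nonneg_nonneg mult_nonneg_nonpos)
  qed
  then have "f t * exp (- M * t) * exp (M * t) \<le> f 0 * exp (M * t)"
    by (intro mult_right_mono) auto
  then show "f t \<le> f 0 * exp (M * t)" by (simp add: mult.assoc exp_add[symmetric])
qed

lemma support_flow:
  assumes \<phi>: "replicator_flow S u \<phi>" and x: "x \<in> strategy_space S" and t: "0 \<le> t"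
  shows "support (\<phi> x t) = support x"
proof -
  have "\<phi> x t $ p $ s = 0 \<longleftrightarrow> x $ p $ s = 0" for p s
  proof -
    note ff = flow_facts[OF \<phi> x]
    note b = exponential_growth_bounds[of "\<lambda>t. \<phi> x t $ p $ s" "\<lambda>t. growth S u p s (\<phi> x t)",
        OF ff(3) strategy_spaceD(1)[OF ff(2)] abs_growth_le[OF ff(2)] t, unfolded ff(1)]
    have "0 \<le> x $ p $ s" "0 \<le> \<phi> x t $ p $ s"
      using strategy_spaceD(1) x ff(2) by blast+
    moreover have "0 < \<phi> x t $ p $ s" if "0 < x $ p $ s"
      using less_le_trans[OF mult_pos_pos[OF that exp_gt_zero] b(1)] .
    ultimately show ?thesis using b(2) by force
  qed
  then show ?thesis by (auto simp: support_def)
qed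

section \<open>Log-odds coordinates on a face\<close>

text \<open>\<open>B p\<close> is the support of player \<open>p\<close> on the face, and
  \<open>r p\<close> the reference strategy against which log-odds are taken.\<close>

locale game_face =
  fixes S :: "'p::finite \<Rightarrow> 's::finite set" and u :: "('p \<Rightarrow> 's) \<Rightarrow> real ^ 'p"
    and \<phi> :: "real ^ 's ^ 'p \<Rightarrow> real \<Rightarrow> real ^ 's ^ 'p"
    and B :: "'p \<Rightarrow> 's set" and r :: "'p \<Rightarrow> 's"
  assumes flow: "replicator_flow S u \<phi>"
    and B_subset: "B p \<subseteq> S p" and r_in: "r p \<in> B p"
begin

definition coords :: "('p \<times> 's) set" where
  "coords = {(p, s). s \<in> B p \<and> s \<noteq> r p}"

definition weight :: "('p \<times> 's \<Rightarrow> real) \<Rightarrow> 'p \<Rightarrow> 's \<Rightarrow> real" where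
  "weight y p s = (if s \<notin> B p then 0 else if s = r p then 1 else exp (y (p, s)))"

text \<open>The softmax map with the logit of each \<open>r p\<close> fixed at 0; it inverts
  \<open>log_odds\<close> on the face.\<close>

definition mix :: "('p \<times> 's \<Rightarrow> real) \<Rightarrow> real ^ 's ^ 'p" where
  "mix y = (\<chi> p s. weight y p s / (\<Sum>t\<in>B p. weight y p t))"

definition log_odds :: "real ^ 's ^ 'p \<Rightarrow> 'p \<times> 's \<Rightarrow> real" where
  "log_odds x = (\<lambda>(p, s). if (p, s) \<in> coords then ln (x $ p $ s / x $ p $ r p) else undefined)"

definition log_odds_field :: "'p \<times> 's \<Rightarrow> ('p \<times> 's \<Rightarrow> real) \<Rightarrow> real" where
  "log_odds_field = (\<lambda>(p, s) y. deviation_utility S u p s (mix y) - deviation_utility S u p (r p) (mix y))"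

definition face :: "(real ^ 's ^ 'p) set" where
  "face = {x \<in> strategy_space S. support x = Sigma UNIV B}"

lemma faceD:
  assumes "x \<in> face"
  shows "x \<in> strategy_space S" "s \<in> B p \<Longrightarrow> 0 < x $ p $ s" "s \<notin> B p \<Longrightarrow> x $ p $ s = 0"
    "(\<Sum>s\<in>B p. x $ p $ s) = 1"
proof -
  show x: "x \<in> strategy_space S" using assms by (simp add: face_def)
  have *: "x $ p $ s \<noteq> 0 \<longleftrightarrow> s \<in> B p" for s
    using assms unfolding face_def support_def by blast
  then show "s \<in> B p \<Longrightarrow> 0 < x $ p $ s" "s \<notin> B p \<Longrightarrow> x $ p $ s = 0"
    using strategy_spaceD(1)[OF x, of p s] by force+
  have "(\<Sum>s\<in>B p. x $ p $ s) = (\<Sum>s\<in>S p. x $ p $ s)"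
    using * B_subset by (intro sum.mono_neutral_left) auto
  then show "(\<Sum>s\<in>B p. x $ p $ s) = 1" using strategy_spaceD(4)[OF x] by simp
qed

lemma weight_pos: "s \<in> B p \<Longrightarrow> 0 < weight y p s" and weight_nonneg: "0 \<le> weight y p s"
  by (auto simp: weight_def)

lemma sum_weight_pos: "0 < (\<Sum>t\<in>B p. weight y p t)"
  using r_in[of p] weight_pos by (intro sum_pos) auto

lemma mix_in_face: "mix y \<in> face"
proof -
  have nn: "0 \<le> mix y $ p $ s" and out: "s \<notin> B p \<Longrightarrow> mix y $ p $ s = 0"
    and pos: "s \<in> B p \<Longrightarrow> mix y $ p $ s \<noteq> 0" for p s
    using weight_nonneg[of y p s] weight_pos[of s p y] sum_weight_pos[of y p]
    by (auto simp: mix_def weight_def)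
  have "(\<Sum>s\<in>S p. mix y $ p $ s) = (\<Sum>s\<in>B p. mix y $ p $ s)" for p
    using out B_subset by (intro sum.mono_neutral_right) auto
  also have "(\<Sum>s\<in>B p. mix y $ p $ s) = 1" for p
    using sum_weight_pos[of y p] by (simp add: mix_def sum_divide_distrib[symmetric])
  finally have "mix y \<in> strategy_space S"
    using nn out B_subset unfolding strategy_space_def by blast
  then show ?thesis using out pos by (auto simp: face_def support_def)
qed

lemma ln_mix: "(p, s) \<in> coords \<Longrightarrow> ln (mix y $ p $ s / mix y $ p $ r p) = y (p, s)"
  using sum_weight_pos[of y p] r_in[of p] by (simp add: mix_def weight_def coords_def)

lemma mix_log_odds:
  assumes x: "x \<in> face" and y: "\<And>k. k \<in> coords \<Longrightarrow> y k = log_odds x k"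
  shows "mix y = x"
proof -
  have w: "weight y p s = x $ p $ s / x $ p $ r p" for p s
    using faceD(2,3)[OF x, of s p] faceD(2)[OF x r_in, of p] r_in[of p] y[of "(p, s)"]
    by (auto simp: weight_def log_odds_def coords_def)
  then have "(\<Sum>t\<in>B p. weight y p t) = 1 / x $ p $ r p" for p
    using faceD(4)[OF x] by (simp add: sum_divide_distrib[symmetric])
  then show ?thesis
    using faceD(2)[OF x r_in] by (simp add: vec_eq_iff mix_def w) (metis less_irrefl)
qed

text \<open>Changing logits by \<open>\<delta>\<close> changes weights and their sum by factors of
  at most \<open>exp \<delta>\<close>, hence probabilities by at most
  \<open>exp (2 * \<delta>)\<close>, which is below \<open>1 + 4 * \<delta>\<close> when
  \<open>2 * \<delta> \<le> 1\<close>. For larger \<open>\<delta>\<close> the bound exceeds 1 and is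
  trivial.\<close>

lemma mix_lipschitz_aux:
  assumes y: "\<And>k. k \<in> coords \<Longrightarrow> \<bar>y k - y' k\<bar> \<le> \<delta>" and \<delta>: "0 \<le> \<delta>"
  shows "mix y $ p $ s - mix y' $ p $ s \<le> 4 * \<delta>"
proof (cases "2 * \<delta> \<le> 1")
  case False
  have "mix y $ p $ s \<le> 1" "0 \<le> mix y' $ p $ s"
    using strategy_spaceD(1,2) faceD(1)[OF mix_in_face] by blast+
  then show ?thesis using False by linarith
next
  case True
  have le: "weight z p t \<le> exp \<delta> * weight z' p t"
    if "\<And>k. k \<in> coords \<Longrightarrow> z k \<le> \<delta> + z' k" for z z' t
    using that[of "(p, t)"] \<delta> by (auto simp: weight_def coords_def exp_add[symmetric])
  have 1: "weight y p t \<le> exp \<delta> * weight y' p t" for t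
    by (rule le) (use y in fastforce)
  have 2: "weight y' p t \<le> exp \<delta> * weight y p t" for t
    by (rule le) (use y in fastforce)
  let ?W = "\<lambda>y. \<Sum>t\<in>B p. weight y p t"
  have W: "?W y' \<le> exp \<delta> * ?W y" using 2 by (simp add: sum_distrib_left sum_mono)
  have "weight y p s * ?W y' \<le> (exp \<delta> * weight y' p s) * (exp \<delta> * ?W y)"
    using 1 W weight_nonneg sum_weight_pos by (intro mult_mono) (auto simp: less_imp_le)
  then have "mix y $ p $ s \<le> exp (2 * \<delta>) * mix y' $ p $ s"
    using sum_weight_pos[of y p] sum_weight_pos[of y' p] exp_double[of \<delta>]
    by (simp add: mix_def divide_simps power2_eq_square) (simp add: mult_ac)
  moreover have "exp (2 * \<delta>) \<le> 1 + 4 * \<delta>"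
  proof -
    have "exp (2 * \<delta>) \<le> 1 + 2 * \<delta> + (2 * \<delta>)\<^sup>2" using True \<delta> by (intro exp_bound) auto
    also have "(2 * \<delta>)\<^sup>2 \<le> 2 * \<delta>"
      using True \<delta> mult_left_mono[of "2 * \<delta>" 1 "2 * \<delta>"] by (simp add: power2_eq_square)
    finally show ?thesis by simp
  qed
  moreover have x: "0 \<le> mix y' $ p $ s" "mix y' $ p $ s \<le> 1"
    using strategy_spaceD(1,2) faceD(1)[OF mix_in_face] by blast+
  ultimately have "mix y $ p $ s \<le> (1 + 4 * \<delta>) * mix y' $ p $ s"
    by (meson mult_right_mono order_trans)
  moreover have "\<delta> * mix y' $ p $ s \<le> \<delta>" using x(2) \<delta> by (simp add: mult_left_le)
  ultimately show ?thesis by (simp add: algebra_simps)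
qed

lemma mix_lipschitz:
  assumes "\<And>k. k \<in> coords \<Longrightarrow> \<bar>y k - y' k\<bar> \<le> \<delta>" "0 \<le> \<delta>"
  shows "\<bar>mix y $ p $ s - mix y' $ p $ s\<bar> \<le> 4 * \<delta>"
    "dist (mix y) (mix y') \<le> real (CARD('p) * CARD('s)) * (4 * \<delta>)"
proof -
  show *: "\<bar>mix y $ p $ s - mix y' $ p $ s\<bar> \<le> 4 * \<delta>" for p s
    using mix_lipschitz_aux[of y y' \<delta> p s] mix_lipschitz_aux[of y' y \<delta> p s] assms
    by (simp add: abs_minus_commute abs_le_iff)
  show "dist (mix y) (mix y') \<le> real (CARD('p) * CARD('s)) * (4 * \<delta>)"
    unfolding dist_norm by (intro norm_vec_vec_le) (simp add: *)
qed

lemma measurable_mix_nth [measurable]: "(\<lambda>y. mix y $ p $ s) \<in> borel_measurable (lborelP coords)"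
proof -
  have [measurable]: "(\<lambda>y. weight y p s) \<in> borel_measurable (lborelP coords)" for p s
  proof (cases "(p, s) \<in> coords")
    case True
    then have "(\<lambda>y. y (p, s)) \<in> borel_measurable (lborelP coords)"
      using measurable_component_singleton[of "(p, s)" coords "\<lambda>_. lborel"] by simp
    then show ?thesis unfolding weight_def by measurable
  next
    case False
    then have "(\<lambda>y. weight y p s) = (\<lambda>_. if s \<notin> B p then 0 else 1)"
      by (auto simp: weight_def coords_def)
    then show ?thesis by simp
  qed
  show ?thesis unfolding mix_def by simp
qed

lemma measurable_mix [measurable]: "mix \<in> borel_measurable (lborelP coords)"
  by (subst borel_measurable_euclidean_space) (auto simp: Basis_vec_def inner_axis)

lemma mix_update_other: "j \<noteq> p \<Longrightarrow> mix (y((p, s) := c)) $ j = mix y $ j"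
proof -
  assume "j \<noteq> p"
  then have "weight (y((p, s) := c)) j = weight y j" by (auto simp: weight_def)
  then show ?thesis by (simp add: mix_def)
qed

text \<open>The field is a difference of two payoffs, whence the factor 2. In the Lipschitz
  constant, \<open>CARD('p)\<close> comes from the payoffs and 4 from \<open>mix\<close>.\<close>

sublocale solenoidal_field coords log_odds_field
  "2 * total_utility S u" "2 * total_utility S u * real CARD('p) * 4"
proof
  fix k y assume k: "k \<in> coords"
  obtain p s where ps: "k = (p, s)" by (cases k)
  note X = faceD(1)[OF mix_in_face]
  show "\<bar>log_odds_field k y\<bar> \<le> 2 * total_utility S u"
    using abs_deviation_utility_le[OF X[of y], of u p s] abs_deviation_utility_le[OF X[of y], of u p "r p"]
    by (simp add: ps log_odds_field_def)
  show "log_odds_field k (y(k := c)) = log_odds_field k y" for c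
    using deviation_utility_cong[of p "mix (y((p, s) := c))" "mix y" S u]
    by (simp add: ps log_odds_field_def mix_update_other)
  show "log_odds_field k \<in> borel_measurable (lborelP coords)"
    unfolding ps log_odds_field_def deviation_utility_eq prod.case
    by measurable
  fix y' \<delta> assume d: "\<And>j. j \<in> coords \<Longrightarrow> \<bar>y j - y' j\<bar> \<le> \<delta>"
  have \<delta>: "0 \<le> \<delta>" using d[OF k] by linarith
  note L = deviation_utility_lipschitz[OF X[of y] X[of y'] mix_lipschitz(1)[OF d \<delta>], of u p]
  show "\<bar>log_odds_field k y - log_odds_field k y'\<bar> \<le> 2 * total_utility S u * real CARD('p) * 4 * \<delta>"
    using L[of s] L[of "r p"] by (simp add: ps log_odds_field_def)
qed (auto simp: total_utility_nonneg)

lemma flow_in_face: "x \<in> face \<Longrightarrow> 0 \<le> t \<Longrightarrow> \<phi> x t \<in> face"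
  using support_flow[OF flow] flow_facts(2)[OF flow] by (auto simp: face_def)

text \<open>
  In the coordinates \<open>ln (x\<^sup>p\<^sub>s / x\<^sup>p\<^sub>r)\<close> the average payoff cancels, so the velocity of player
  \<open>p\<close>'s coordinates does not depend on them: the field is divergence free.
\<close>

lemma solution_log_odds_flow:
  assumes x: "x \<in> face"
  shows "solution (\<lambda>t. log_odds (\<phi> x t))"
  unfolding solution_def
proof (intro ballI allI impI)
  fix k and t :: real assume k: "k \<in> coords" and t: "0 \<le> t"
  obtain p s where ps: "k = (p, s)" by (cases k)
  then have s: "s \<in> B p" using k by (auto simp: coords_def)
  have X: "x \<in> strategy_space S" by (rule faceD(1)[OF x])
  note f = flow_in_face[OF x t]
  have pos: "0 < \<phi> x t $ p $ s" "0 < \<phi> x t $ p $ r p"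
    using faceD(2)[OF f] s r_in by auto
  note der = flow_facts(3)[OF flow X, of p _ t]
  have "((\<lambda>t. ln (\<phi> x t $ p $ s / \<phi> x t $ p $ r p)) has_real_derivative
      growth S u p s (\<phi> x t) - growth S u p (r p) (\<phi> x t)) (at t)"
    by (rule derivative_eq_intros der refl | use pos in \<open>simp add: field_simps\<close>)+
  moreover have "mix (log_odds (\<phi> x t)) = \<phi> x t" by (rule mix_log_odds[OF f refl])
  ultimately show "((\<lambda>t. log_odds (\<phi> x t) k) has_real_derivative log_odds_field k (log_odds (\<phi> x t))) (at t)"
    using k by (simp add: ps log_odds_def log_odds_field_def growth_def)
qed

section \<open>Absorbing sets inside a face\<close>

lemma dist_transfer_mass_less:
  fixes w :: "real ^ 's ^ 'p"
  assumes "0 \<le> c" "2 * c < \<epsilon>"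
  shows "dist w (w + axis p (c *\<^sub>R (axis t 1 - axis s 1))) < \<epsilon>"
proof -
  have "norm (axis t 1 - axis s (1::real)) \<le> 1 + (1::real)"
    by (intro order_trans[OF norm_triangle_ineq4]) simp
  then have "c * norm (axis t 1 - axis s (1::real)) \<le> c * 2"
    using assms by (intro mult_left_mono) auto
  moreover have "norm (axis p v) \<le> norm v" for v :: "real ^ 's"
  proof -
    have "norm (axis p v) \<le> (\<Sum>i\<in>UNIV. norm (axis p v $ i))"
      unfolding norm_vec_def[of "axis p v"] by (rule L2_set_le_sum) simp
    also have "\<dots> = (\<Sum>i\<in>UNIV. if i = p then norm v else 0)"
      by (intro sum.cong) (auto simp: axis_def)
    finally show ?thesis by simp
  qed
  from this[of "c *\<^sub>R (axis t 1 - axis s 1)"]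
  have "norm (axis p (c *\<^sub>R (axis t 1 - axis s (1::real)))) \<le> c * norm (axis t 1 - axis s (1::real))"
    using assms by simp
  ultimately show ?thesis using assms by (simp add: dist_norm)
qed

text \<open>Otherwise, moving the mass of \<open>s\<close> to another strategy leads from \<open>w\<close> to a smaller face.\<close>

lemma face_coordinate_ge:
  assumes w: "w \<in> face"
    and near: "\<And>z. z \<in> strategy_space S \<Longrightarrow> support z \<subseteq> Sigma UNIV B \<Longrightarrow> dist w z < \<epsilon> \<Longrightarrow> z \<in> face"
    and st: "s \<in> B p" "t \<in> B p" "s \<noteq> t"
  shows "\<epsilon> / 2 \<le> w $ p $ s"
proof (rule ccontr)
  assume "\<not> ?thesis"
  then have small: "2 * w $ p $ s < \<epsilon>" by simp
  note W = faceD[OF w]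
  define z where "z = w + axis p (w $ p $ s *\<^sub>R (axis t 1 - axis s 1))"
  have z: "z $ q $ v = (if q = p \<and> v = s then 0 else if q = p \<and> v = t then w $ p $ t + w $ p $ s else w $ q $ v)"
    for q v using st(3) by (simp add: z_def axis_def)
  have nn: "0 \<le> w $ q $ v" for q v using strategy_spaceD(1)[OF W(1)] .
  have "(\<Sum>v\<in>S q. z $ q $ v) = 1" for q
  proof (cases "q = p")
    case True
    have S: "s \<in> S p" "t \<in> S p" using st B_subset by auto
    have "(\<Sum>v\<in>S p. z $ p $ v)
        = (\<Sum>v\<in>S p. w $ p $ v + w $ p $ s * ((if v = t then 1 else 0) - (if v = s then 1 else 0)))"
      by (intro sum.cong refl) (use st(3) in \<open>auto simp: z\<close>)
    also have "\<dots> = 1"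
      using S strategy_spaceD(4)[OF W(1), of p]
      by (simp add: sum.distrib sum_distrib_left[symmetric] sum_subtractf)
    finally show ?thesis using True by simp
  next
    case False
    then show ?thesis using strategy_spaceD(4)[OF W(1), of q] by (simp add: z)
  qed
  moreover have out: "z $ q $ v = 0" if "v \<notin> B q" for q v
    using that W(3)[OF that] st by (auto simp: z)
  moreover have "z $ q $ v = 0" if "v \<notin> S q" for q v
    using that out B_subset by blast
  moreover have "0 \<le> z $ q $ v" for q v using nn by (simp add: z)
  ultimately have "z \<in> strategy_space S" "support z \<subseteq> Sigma UNIV B"
    using B_subset by (auto simp: strategy_space_def support_def)
  moreover have "dist w z < \<epsilon>" unfolding z_def using nn small by (intro dist_transfer_mass_less)
  ultimately have "z \<in> face" by (rule near)
  then show False using faceD(2)[OF _ st(1), of z] by (simp add: z)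
qed

text \<open>\<open>absorb\<close> ranges over the closed face, while \<open>R\<close> lies in its
  relative interior. So time-\<open>T\<close> images of \<open>R\<close> keep a distance from the
  boundary, which gives boundedness in log-odds.\<close>

lemma no_absorbing_set_in_face:
  assumes \<epsilon>: "0 < \<epsilon>" and T: "0 < T" and k: "k \<in> coords"
    and R: "R \<subseteq> face" "R \<noteq> {}"
    and absorb: "\<And>x z. x \<in> R \<Longrightarrow> z \<in> strategy_space S \<Longrightarrow> support z \<subseteq> Sigma UNIV B \<Longrightarrow>
      dist (\<phi> x T) z < \<epsilon> \<Longrightarrow> z \<in> R"
  shows False
proof -
  \<comment> \<open>\<open>R\<close> need not be measurable. The open neighbourhood \<open>U\<close>
    of its image replaces it: points of the face in \<open>U\<close> lie in \<open>R\<close>, so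
    \<open>A\<close> is absorbing too.\<close>
  define U where "U = (\<Union>x\<in>R. ball (\<phi> x T) \<epsilon>)"
  define A where "A = {y \<in> space (lborelP coords). mix y \<in> U}"
  have "open U" by (auto simp: U_def)
  then have A_sets: "A \<in> sets (lborelP coords)"
    using measurable_sets[OF measurable_mix, of U] by (simp add: A_def vimage_def Int_def conj_commute)
  have mix_R: "mix y \<in> R" if "mix y \<in> U" for y
  proof -
    from that obtain x where "x \<in> R" "dist (\<phi> x T) (mix y) < \<epsilon>" by (auto simp: U_def)
    then show ?thesis using absorb[of x "mix y"] mix_in_face[of y] by (auto simp: face_def)
  qed
  define N where "N = real (CARD('p) * CARD('s)) * 4"
  have N: "0 < N" by (simp add: N_def)
  \<comment> \<open>\<open>N\<close> is a Lipschitz constant of \<open>mix\<close>. The budget of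
    \<open>2 * \<delta>\<close> pays once for the error of \<open>\<Psi>\<close> and once for a
    further displacement such as the shift of coordinate \<open>k\<close>.\<close>
  define \<delta> where "\<delta> = \<epsilon> / (4 * N)"
  have \<delta>: "0 < \<delta>" "N * (2 * \<delta>) < \<epsilon>" using \<epsilon> N by (auto simp: \<delta>_def)
  have near: "dist (mix y) (mix y') < \<epsilon>" if "\<And>k. k \<in> coords \<Longrightarrow> \<bar>y k - y' k\<bar> \<le> 2 * \<delta>" for y y'
    using mix_lipschitz(2)[of y y' "2 * \<delta>"] that \<delta> by (simp add: N_def)
  obtain \<Psi> where \<Psi>: "measure_preserving_on (lborelP coords) \<Psi>"
    "\<And>Y y k. solution Y \<Longrightarrow> (\<And>j. j \<in> coords \<Longrightarrow> Y 0 j = y j) \<Longrightarrow> k \<in> coords \<Longrightarrow> \<bar>Y T k - \<Psi> y k\<bar> \<le> \<delta>"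
    using measure_preserving_approximation[OF T \<delta>(1)] by blast
  define Y where "Y y t = log_odds (\<phi> (mix y) t)" for y t
  have Y: "solution (Y y)" "mix (Y y T) = \<phi> (mix y) T" "\<And>j. j \<in> coords \<Longrightarrow> Y y 0 j = y j" for y
  proof -
    show "solution (Y y)" unfolding Y_def by (rule solution_log_odds_flow[OF mix_in_face])
    show "mix (Y y T) = \<phi> (mix y) T"
      unfolding Y_def using T by (intro mix_log_odds flow_in_face mix_in_face) auto
    fix j assume "j \<in> coords"
    then show "Y y 0 j = y j"
      using flow_facts(1)[OF flow faceD(1)[OF mix_in_face], of y] ln_mix[of "fst j" "snd j" y]
      by (cases j) (simp add: Y_def log_odds_def)
  qed
  have into: "y' \<in> A" if y: "y \<in> A" and y': "y' \<in> space (lborelP coords)"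
    and d: "\<And>j. j \<in> coords \<Longrightarrow> \<bar>\<Psi> y j - y' j\<bar> \<le> \<delta>" for y y'
  proof -
    have "mix y \<in> R" using y mix_R by (simp add: A_def)
    moreover have "dist (mix (Y y T)) (mix y') < \<epsilon>"
    proof (rule near)
      fix j assume j: "j \<in> coords"
      then show "\<bar>Y y T j - y' j\<bar> \<le> 2 * \<delta>" using \<Psi>(2)[OF Y(1,3) j, of y] d[OF j] by linarith
    qed
    ultimately show ?thesis using y' by (auto simp: A_def U_def Y(2))
  qed
  have \<Psi>_space: "\<Psi> y \<in> space (lborelP coords)" if "y \<in> A" for y
    using measurable_space[of \<Psi> "lborelP coords" "lborelP coords" y] \<Psi>(1) that
    by (simp add: A_def measure_preserving_on_def)
  have "emeasure (lborelP coords) A = 0"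
  proof (rule emeasure_absorbing_eq_0[OF finite_I k \<Psi>(1) A_sets _ \<delta>(1)])
    fix y assume y: "y \<in> A"
    show "\<Psi> y \<in> A" using into[OF y \<Psi>_space[OF y]] \<delta>(1) by simp
    have "(\<Psi> y)(k := \<Psi> y k + \<delta>) \<in> space (lborelP coords)"
      using \<Psi>_space[OF y] k by (auto simp: space_PiM PiE_iff extensional_def)
    then show "(\<Psi> y)(k := \<Psi> y k + \<delta>) \<in> A"
      using into[OF y] \<delta>(1) by simp
    \<comment> \<open>Boundedness is read off at time \<open>T\<close>: there the relevant
      probabilities lie between \<open>\<epsilon> / 2\<close> and 1, which bounds the log-odds.
      Going back to time 0 costs at most \<open>T\<close> times the bound on the field.\<close>
    fix j assume j: "j \<in> coords"
    obtain p s where ps: "j = (p, s)" by (cases j)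
    have yR: "mix y \<in> R" using y mix_R by (simp add: A_def)
    define w where "w = \<phi> (mix y) T"
    have w: "w \<in> face" unfolding w_def using T by (intro flow_in_face mix_in_face) auto
    have ge: "\<epsilon> / 2 \<le> w $ p $ s'" if "s' \<in> B p" "t \<in> B p" "s' \<noteq> t" for s' t
      using face_coordinate_ge[OF w _ that] absorb[OF yR] R(1) by (auto simp: w_def)
    have b: "\<epsilon> / 2 \<le> w $ p $ s" "\<epsilon> / 2 \<le> w $ p $ r p" "w $ p $ s \<le> 1" "w $ p $ r p \<le> 1"
      using ge[of s "r p"] ge[of "r p" s] j r_in[of p] strategy_spaceD(2)[OF faceD(1)[OF w]]
      by (auto simp: coords_def ps)
    have "ln (\<epsilon> / 2) \<le> ln (w $ p $ v) \<and> ln (w $ p $ v) \<le> 0" if "\<epsilon> / 2 \<le> w $ p $ v" "w $ p $ v \<le> 1" for v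
      using that \<epsilon> by auto
    note this[of s, OF b(1,3)] this[of "r p", OF b(2,4)]
    moreover have "ln (w $ p $ s / w $ p $ r p) = ln (w $ p $ s) - ln (w $ p $ r p)"
      using b \<epsilon> by (simp add: ln_div)
    ultimately have "\<bar>ln (w $ p $ s / w $ p $ r p)\<bar> \<le> - ln (\<epsilon> / 2)" by linarith
    then have "\<bar>Y y T j\<bar> \<le> - ln (\<epsilon> / 2)" using j by (simp add: Y_def log_odds_def ps w_def)
    moreover have "\<bar>Y y T j - y j\<bar> \<le> T * (2 * total_utility S u)"
      using solution_drift(1)[OF Y(1)[of y] j, of 0 T] T Y(3)[OF j] by simp
    ultimately show "\<bar>y j\<bar> \<le> T * (2 * total_utility S u) - ln (\<epsilon> / 2)" by linarith
  qed
  moreover have "emeasure (lborelP coords) A > 0"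
  proof -
    obtain x where x: "x \<in> R" using R by blast
    define y0 where "y0 = log_odds (\<phi> x T)"
    have y0: "mix y0 = \<phi> x T"
      unfolding y0_def using x R T by (intro mix_log_odds flow_in_face) auto
    have "Pi\<^sub>E coords (\<lambda>k. {y0 k - \<delta> .. y0 k + \<delta>}) \<subseteq> A"
    proof
      fix y assume y: "y \<in> Pi\<^sub>E coords (\<lambda>k. {y0 k - \<delta> .. y0 k + \<delta>})"
      have "dist (mix y0) (mix y) < \<epsilon>"
      proof (rule near)
        fix j assume "j \<in> coords"
        then have "y j \<in> {y0 j - \<delta> .. y0 j + \<delta>}" using y by (rule PiE_mem[rotated])
        then show "\<bar>y0 j - y j\<bar> \<le> 2 * \<delta>" using \<delta>(1) by auto
      qed
      then show "y \<in> A" using x y y0 by (auto simp: A_def U_def space_PiM PiE_iff)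
    qed
    then show ?thesis
      using emeasure_PiE_box_pos[OF finite_I \<delta>(1), of y0] emeasure_mono[OF _ A_sets]
      by (meson less_le_trans)
  qed
  ultimately show False by simp
qed

end

section \<open>Pseudo-orbits between pure profiles\<close>

lemma pure_in_strategy_space: "q \<in> profiles S \<Longrightarrow> pure q \<in> strategy_space S"
  by (auto simp: pure_def strategy_space_def profiles_def axis_def)

lemma support_singletons_imp_pure:
  assumes x: "x \<in> strategy_space S" and q: "support x \<subseteq> {(p, q p) |p. True}"
  shows "x = pure q" "q \<in> profiles S"
proof -
  have z: "x $ p $ s = 0" if "s \<noteq> q p" for p s using q that by (auto simp: support_def)
  have *: "q p \<in> S p \<and> x $ p $ q p = 1" for p
  proof -
    have "(\<Sum>s\<in>S p. x $ p $ s) = (\<Sum>s\<in>S p. if s = q p then x $ p $ q p else 0)"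
      using z by (intro sum.cong) auto
    then show ?thesis using strategy_spaceD(4)[OF x, of p] by (simp split: if_splits)
  qed
  then show "q \<in> profiles S" by (simp add: profiles_def)
  show "x = pure q" using * z by (auto simp: vec_eq_iff pure_def axis_def)
qed

lemma chain_to_pure:
  assumes \<phi>: "replicator_flow S u \<phi>" and x: "x \<in> strategy_space S" and \<epsilon>: "0 < \<epsilon>" and T: "0 < T"
  shows "\<exists>q\<in>profiles S. (x, pure q) \<in> (chain_step (strategy_space S) \<phi> \<epsilon> T)\<^sup>+"
proof -
  let ?X = "strategy_space S"
  define Re where "Re = {z. (x, z) \<in> (chain_step ?X \<phi> \<epsilon> T)\<^sup>+}"
  have step: "z' \<in> Re" if "z \<in> Re \<or> z = x" "z' \<in> ?X" "T \<le> t" "dist (\<phi> z t) z' < \<epsilon>" for z z' t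
  proof -
    have "(z, z') \<in> chain_step ?X \<phi> \<epsilon> T"
      using that x chain_step_trancl_in[of x z ?X \<phi> \<epsilon> T] by (intro chain_stepI[of _ _ _ _ t]) (auto simp: Re_def)
    then show ?thesis using that(1) by (auto simp: Re_def intro: trancl_into_trancl)
  qed
  have "\<phi> x T \<in> Re" using step[of x "\<phi> x T" T] flow_facts(2)[OF \<phi> x] \<epsilon> by simp
  then obtain w where w: "w \<in> Re" "\<And>z. z \<in> Re \<Longrightarrow> card (support w) \<le> card (support z)"
    using ex_has_least_nat[of "\<lambda>z. z \<in> Re" "\<phi> x T" "\<lambda>z. card (support z)"] by blast
  have X: "z \<in> ?X" if "z \<in> Re" for z using that chain_step_trancl_in unfolding Re_def by blast
  define B where "B p = {s. w $ p $ s \<noteq> 0}" for p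
  define r where "r p = (SOME s. s \<in> B p)" for p
  have supp_w: "support w = Sigma UNIV B" by (auto simp: support_def B_def)
  have ne: "B p \<noteq> {}" for p
    using strategy_spaceD(4)[OF X[OF w(1)], of p] sum.neutral[of "S p" "\<lambda>s. w $ p $ s"]
    by (fastforce simp: B_def)
  interpret game_face S u \<phi> B r
  proof
    show "r p \<in> B p" for p unfolding r_def using ne[of p] by (simp add: some_in_eq)
    show "B p \<subseteq> S p" for p using strategy_spaceD(3)[OF X[OF w(1)]] by (auto simp: B_def)
  qed (rule \<phi>)
  show ?thesis
  proof (cases "coords = {}")
    case True
    then have "support w \<subseteq> {(p, r p) |p. True}" by (auto simp: supp_w coords_def)
    from support_singletons_imp_pure[OF X[OF w(1)] this] w(1) show ?thesis by (auto simp: Re_def)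
  next
    case False
    then obtain k where k: "k \<in> coords" by blast
    \<comment> \<open>Minimality of the support of \<open>w\<close>: a reachable point with support
      inside it has the same support.\<close>
    have full: "z \<in> face" if "z \<in> Re" "support z \<subseteq> Sigma UNIV B" for z
    proof -
      have "support z = Sigma UNIV B"
        using card_seteq[OF finite that(2)] w(2)[OF that(1)] by (simp add: supp_w)
      then show ?thesis using X[OF that(1)] by (simp add: face_def)
    qed
    have "w \<in> Re \<inter> face" using w(1) full by (simp add: supp_w)
    then have False
      using full step by (intro no_absorbing_set_in_face[OF \<epsilon> T k, of "Re \<inter> face"]) blast+
    then show ?thesis ..
  qed
qed

text \<open>The profile from \<open>chain_to_pure\<close> may vary with \<open>\<epsilon>\<close>
  and \<open>T\<close>; as there are finitely many, one serves for all.\<close>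

lemma pseudo_orbit_to_pure:
  assumes "replicator_flow S u \<phi>" "x \<in> strategy_space S"
  shows "\<exists>q\<in>profiles S. pseudo_orbit (strategy_space S) \<phi> x (pure q)"
  using pseudo_orbit_finite_targets[of "pure ` profiles S" x "strategy_space S" \<phi>]
    chain_to_pure[OF assms] by (simp add: bex_simps)

lemma flow_pure:
  assumes \<phi>: "replicator_flow S u \<phi>" and q: "q \<in> profiles S" and t: "0 \<le> t"
  shows "\<phi> (pure q) t = pure q"
proof (rule support_singletons_imp_pure)
  note X = pure_in_strategy_space[OF q]
  show "\<phi> (pure q) t \<in> strategy_space S" by (rule flow_facts(2)[OF \<phi> X])
  show "support (\<phi> (pure q) t) \<subseteq> {(p, q p) |p. True}"
    unfolding support_flow[OF \<phi> X t] by (auto simp: support_def pure_def axis_def split: if_splits)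
qed

lemma pseudo_orbit_pure_refl:
  assumes \<phi>: "replicator_flow S u \<phi>" and q: "q \<in> profiles S"
  shows "pseudo_orbit (strategy_space S) \<phi> (pure q) (pure q)"
  unfolding pseudo_orbit_iff
proof (intro allI impI)
  fix \<epsilon> T :: real assume "0 < \<epsilon>" "0 < T"
  then show "(pure q, pure q) \<in> (chain_step (strategy_space S) \<phi> \<epsilon> T)\<^sup>+"
    using pure_in_strategy_space[OF q] flow_pure[OF \<phi> q, of T]
    by (intro r_into_trancl chain_stepI[of _ _ _ _ T]) auto
qed

text \<open>
  On the edge from \<open>a\<close> to \<open>b\<close> the log-odds coordinate has constant speed \<open>\<Delta> = u\<^sub>i(b) - u\<^sub>i(a) \<ge> 0\<close>.
  Adding a small push \<open>c\<close> at each step makes it arbitrarily large even when \<open>\<Delta> = 0\<close>.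
\<close>

lemma pseudo_orbit_response_arc:
  assumes \<phi>: "replicator_flow S u \<phi>" and arc: "(a, b) \<in> response_graph S u"
  shows "pseudo_orbit (strategy_space S) \<phi> (pure a) (pure b)"
  unfolding pseudo_orbit_iff
proof (intro allI impI)
  let ?X = "strategy_space S"
  from arc obtain i where a: "a \<in> profiles S" and b: "b \<in> profiles S"
    and i: "a i \<noteq> b i" "\<And>j. j \<noteq> i \<Longrightarrow> a j = b j" and le: "u a $ i \<le> u b $ i"
    by (auto simp: response_graph_def comparable_def)
  fix \<epsilon> T :: real assume \<epsilon>: "0 < \<epsilon>" and T: "0 < T"
  interpret game_face S u \<phi> "\<lambda>p. {a p, b p}" a
    using a b by unfold_locales (auto simp: \<phi> profiles_def)
  have coords: "coords = {(i, b i)}" using i unfolding coords_def by (safe; simp; metis)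
  \<comment> \<open>\<open>e v\<close> parametrizes the open edge by the log-odds of
    \<open>b i\<close> against \<open>a i\<close>: it tends to \<open>pure a\<close> as
    \<open>v\<close> decreases and to \<open>pure b\<close> as \<open>v\<close> increases.\<close>
  define e where "e v = mix (\<lambda>_. v)" for v
  have eX: "e v \<in> ?X" for v unfolding e_def by (rule faceD(1)[OF mix_in_face])
  have e_eq: "mix y = e (y (i, b i))" for y
    by (auto simp: e_def mix_def weight_def vec_eq_iff) (use i in metis)+
  have comp: "e v $ p $ s = (if p = i then (if s = b i then exp v / (1 + exp v) else if s = a i then 1 / (1 + exp v) else 0)
      else axis (a p) 1 $ s)" for v p s
    using i by (auto simp: e_def mix_def weight_def axis_def)
  define N where "N = real (CARD('a) * CARD('b))"
  have N: "0 < N" by (simp add: N_def)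
  have ea: "dist (pure a) (e v) \<le> N * exp v" for v
    unfolding dist_norm N_def
  proof (rule norm_vec_vec_le)
    have "1 + exp v \<noteq> 0" by (metis add_pos_pos exp_gt_zero less_irrefl zero_less_one)
    then have "exp v / (1 + exp v) \<le> exp v" "1 - 1 / (1 + exp v) = exp v / (1 + exp v)"
      by (auto simp: field_simps add_pos_pos)
    then show "\<bar>(pure a - e v) $ p $ s\<bar> \<le> exp v" for p s
      using i by (auto simp: comp pure_def axis_def)
  qed
  have eb: "dist (e v) (pure b) \<le> N * exp (- v)" for v
    unfolding dist_norm N_def
  proof (rule norm_vec_vec_le)
    have "1 + exp v \<noteq> 0" by (metis add_pos_pos exp_gt_zero less_irrefl zero_less_one)
    then have "1 / (1 + exp v) \<le> exp (- v)" "exp v / (1 + exp v) - 1 = - (1 / (1 + exp v))"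
      by (auto simp: field_simps add_pos_pos exp_minus)
    then show "\<bar>(e v - pure b) $ p $ s\<bar> \<le> exp (- v)" for p s
      using i by (auto simp: comp pure_def axis_def)
  qed
  define \<Delta> where "\<Delta> = u b $ i - u a $ i"
  have \<Delta>: "0 \<le> \<Delta>" using le by (simp add: \<Delta>_def)
  have field: "log_odds_field (i, b i) y = \<Delta>" for y
  proof -
    have ax: "mix y $ j = axis (a j) 1" if "j \<noteq> i" for j
      using that by (simp add: e_eq vec_eq_iff comp)
    have "a(i := b i) = b" "a(i := a i) = a" using i by auto
    then show ?thesis
      using deviation_utility_pure[of i "mix y" a "b i" S u] deviation_utility_pure[of i "mix y" a "a i" S u] ax a b
      by (simp add: log_odds_field_def \<Delta>_def)
  qed
  have flow_e: "\<phi> (e v) T = e (v + T * \<Delta>)" for v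
  proof -
    let ?Y = "\<lambda>t. log_odds (\<phi> (e v) t)"
    have f: "e v \<in> face" unfolding e_def by (rule mix_in_face)
    have m: "(i, b i) \<in> coords" by (simp add: coords)
    obtain \<xi> where "?Y T (i, b i) - ?Y 0 (i, b i) = (T - 0) * log_odds_field (i, b i) (?Y \<xi>)"
      using solution_drift(2)[OF solution_log_odds_flow[OF f] m, of 0 T] T by auto
    moreover have "?Y 0 (i, b i) = v"
      using flow_facts(1)[OF \<phi> eX] ln_mix[OF m, of "\<lambda>_. v"] m by (simp add: log_odds_def e_def)
    ultimately have "?Y T (i, b i) = v + T * \<Delta>" by (simp add: field)
    moreover have "\<phi> (e v) T = mix (?Y T)"
      using T flow_in_face[OF f, of T] by (intro mix_log_odds[symmetric]) auto
    ultimately show ?thesis using e_eq[of "?Y T"] by simp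
  qed
  let ?R = "(chain_step ?X \<phi> \<epsilon> T)\<^sup>+"
  \<comment> \<open>A push by \<open>c\<close> in log-odds moves a point by at most
    \<open>N * (4 * c)\<close>, which equals \<open>\<epsilon> / 2\<close>.\<close>
  define c where "c = \<epsilon> / (8 * N)"
  have c: "0 < c" "N * (4 * c) < \<epsilon>" using \<epsilon> N by (auto simp: c_def)
  \<comment> \<open>Chosen so that \<open>N * exp v0\<close> is \<open>\<epsilon> / 2\<close>:
    \<open>e v0\<close> is then close to \<open>pure a\<close>, and every \<open>e v\<close> with
    \<open>v\<close> at least \<open>- v0\<close> is close to \<open>pure b\<close>.\<close>
  define v0 where "v0 = ln (\<epsilon> / (2 * N))"
  have v0: "N * exp v0 < \<epsilon>" using \<epsilon> N by (simp add: v0_def)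
  have climb: "(pure a, e (v0 + real n * (T * \<Delta> + c))) \<in> ?R" for n
  proof (induction n)
    case 0
    have "dist (pure a) (e v0) < \<epsilon>" using ea[of v0] v0 by linarith
    then show ?case
      using flow_pure[OF \<phi> a, of T] T pure_in_strategy_space[OF a] eX
      by (intro r_into_trancl chain_stepI[of _ _ _ _ T]) auto
  next
    case (Suc n)
    let ?v = "v0 + real n * (T * \<Delta> + c)"
    have "dist (e (?v + T * \<Delta>)) (e (?v + T * \<Delta> + c)) < \<epsilon>"
      using mix_lipschitz(2)[of "\<lambda>_. ?v + T * \<Delta>" "\<lambda>_. ?v + T * \<Delta> + c" c] c
      by (simp add: e_def N_def)
    then have "(e ?v, e (?v + T * \<Delta> + c)) \<in> chain_step ?X \<phi> \<epsilon> T"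
      using eX by (intro chain_stepI[of _ _ _ _ T]) (auto simp: flow_e)
    moreover have "?v + T * \<Delta> + c = v0 + real (Suc n) * (T * \<Delta> + c)" by (simp add: algebra_simps)
    ultimately show ?case using Suc by (metis trancl_into_trancl)
  qed
  \<comment> \<open>Enough pushes to carry the log-odds from \<open>v0\<close> past
    \<open>- v0\<close>, even without help from the drift.\<close>
  obtain n where n: "- 2 * v0 < real n * c" using reals_Archimedean3[OF c(1)] by blast
  let ?v = "v0 + real n * (T * \<Delta> + c)"
  have "- v0 \<le> ?v + T * \<Delta>"
  proof -
    have "0 \<le> T * \<Delta>" "0 \<le> real n * (T * \<Delta>)" using T \<Delta> by auto
    then show ?thesis using n by (simp add: algebra_simps)
  qed
  then have "N * exp (- (?v + T * \<Delta>)) \<le> N * exp v0" using N by (intro mult_left_mono) auto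
  then have "dist (e (?v + T * \<Delta>)) (pure b) < \<epsilon>" using eb[of "?v + T * \<Delta>"] v0 by linarith
  then have "(e ?v, pure b) \<in> chain_step ?X \<phi> \<epsilon> T"
    using eX pure_in_strategy_space[OF b] by (intro chain_stepI[of _ _ _ _ T]) (auto simp: flow_e)
  with climb[of n] show "(pure a, pure b) \<in> ?R" by (rule trancl_into_trancl)
qed

lemma pseudo_orbit_response_path:
  assumes \<phi>: "replicator_flow S u \<phi>" and a: "a \<in> profiles S" and path: "(a, b) \<in> (response_graph S u)\<^sup>*"
  shows "pseudo_orbit (strategy_space S) \<phi> (pure a) (pure b)"
  using path
proof (induction rule: rtrancl_induct)
  case base
  show ?case by (rule pseudo_orbit_pure_refl[OF \<phi> a])
next
  case (step b c)
  then show ?case using pseudo_orbit_trans pseudo_orbit_response_arc[OF \<phi>] by blast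
qed

section \<open>Sink connected components of the response graph\<close>

lemma response_path_in_profiles:
  "(a, b) \<in> (response_graph S u)\<^sup>* \<Longrightarrow> a \<in> profiles S \<Longrightarrow> b \<in> profiles S"
  by (induction rule: rtrancl_induct) (auto simp: response_graph_def)

lemma attracting_reachable:
  "a \<in> profiles S \<Longrightarrow> attracting S u ((response_graph S u)\<^sup>* `` {a})"
  unfolding attracting_def using response_path_in_profiles by (force intro: rtrancl_trans)

text \<open>Among the nonempty attracting subsets of the reachable set, one of least cardinality is
  minimal.\<close>

lemma sink_connected_component_reachable:
  assumes a: "a \<in> profiles S"
  shows "\<exists>H. sink_connected_component S u H \<and> H \<subseteq> (response_graph S u)\<^sup>* `` {a}"
proof -
  let ?P = "\<lambda>A. A \<noteq> {} \<and> attracting S u A \<and> A \<subseteq> (response_graph S u)\<^sup>* `` {a}"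
  have "?P ((response_graph S u)\<^sup>* `` {a})" using attracting_reachable[OF a] by blast
  from ex_has_least_nat[of ?P, OF this, of card]
  obtain H where H: "?P H" and least: "\<forall>A. ?P A \<longrightarrow> card H \<le> card A" by (elim exE conjE) (rule that, simp_all)
  have "A = H" if "A \<noteq> {}" "attracting S u A" "A \<subseteq> H" for A
  proof (rule card_seteq[OF finite that(3)])
    have "A \<subseteq> (response_graph S u)\<^sup>* `` {a}" using that(3) H(1) by (meson order_trans)
    then show "card H \<le> card A" using that by (intro least[rule_format]) simp
  qed
  then have "sink_connected_component S u H"
    using H unfolding sink_connected_component_def by blast
  then show ?thesis using H by blast
qed

text \<open>What is reachable from \<open>a\<close> is itself a nonempty attracting subset of
  \<open>H\<close>, so by minimality it is all of \<open>H\<close>.\<close>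

lemma sink_connected_component_strongly_connected:
  assumes "sink_connected_component S u H" "a \<in> H" "b \<in> H"
  shows "(a, b) \<in> (response_graph S u)\<^sup>*"
proof -
  have H: "attracting S u H" "H \<subseteq> profiles S"
    using assms(1) by (auto simp: sink_connected_component_def attracting_def)
  have "(response_graph S u)\<^sup>* `` {a} \<subseteq> H" using H(1) assms(2) by (auto simp: attracting_def)
  moreover have "attracting S u ((response_graph S u)\<^sup>* `` {a})"
    using H(2) assms(2) by (intro attracting_reachable) auto
  moreover have "(response_graph S u)\<^sup>* `` {a} \<noteq> {}" by blast
  ultimately have "(response_graph S u)\<^sup>* `` {a} = H"
    using assms(1) unfolding sink_connected_component_def by simp
  then show ?thesis using assms(3) by blast
qed

theorem theorem4p1:
  fixes S :: "'p::finite \<Rightarrow> 's::finite set"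
    and u :: "('p \<Rightarrow> 's) \<Rightarrow> real ^ 'p"
    and \<phi> :: "real ^ 's ^ 'p \<Rightarrow> real \<Rightarrow> real ^ 's ^ 'p"
    and x :: "real ^ 's ^ 'p"
  assumes "\<And>p. S p \<noteq> {}"
    and "replicator_flow S u \<phi>"
    and "x \<in> strategy_space S"
    and "chain_recurrent (strategy_space S) \<phi> x"
  shows "\<exists>H y. sink_connected_component S u H \<and> y \<in> H \<and>
           pseudo_orbit (strategy_space S) \<phi> x (pure y) \<and>
           (\<exists>C. sink_chain_component (strategy_space S) \<phi> C \<and> pure ` H \<subseteq> C)"
proof -
  note \<phi> = assms(2)
  let ?X = "strategy_space S"
  let ?po = "pseudo_orbit ?X \<phi>"
  \<comment> \<open>Minimizing \<open>card (D q)\<close> over the pure profiles reachable from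
    \<open>x\<close> selects a minimal element of the pseudo-orbit preorder.\<close>
  define D where "D q = {q' \<in> profiles S. ?po (pure q) (pure q')}" for q
  obtain q0 where "q0 \<in> profiles S \<and> ?po x (pure q0)"
    using pseudo_orbit_to_pure[OF \<phi> assms(3)] by blast
  then obtain q where q: "q \<in> profiles S" "?po x (pure q)"
    and min: "\<And>q'. q' \<in> profiles S \<Longrightarrow> ?po x (pure q') \<Longrightarrow> card (D q) \<le> card (D q')"
    using ex_has_least_nat[of "\<lambda>q. q \<in> profiles S \<and> ?po x (pure q)" q0 "\<lambda>q. card (D q)"] by blast
  \<comment> \<open>Transitivity gives \<open>D q' \<subseteq> D q\<close>; least cardinality forces
    equality, and \<open>q\<close> belongs to \<open>D q\<close>.\<close>
  have returns: "?po (pure q') (pure q)" if q': "q' \<in> D q" for q'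
  proof -
    have "D q' \<subseteq> D q" using q' pseudo_orbit_trans by (fastforce simp: D_def)
    moreover have "card (D q) \<le> card (D q')"
      using q' pseudo_orbit_trans[OF q(2)] by (intro min) (auto simp: D_def)
    ultimately have "D q' = D q" by (intro card_seteq) auto
    moreover have "q \<in> D q" using q(1) pseudo_orbit_pure_refl[OF \<phi>] by (simp add: D_def)
    ultimately show ?thesis by (auto simp: D_def)
  qed
  obtain H where H: "sink_connected_component S u H" "H \<subseteq> (response_graph S u)\<^sup>* `` {q}"
    using sink_connected_component_reachable[OF q(1)] by blast
  then obtain y where y: "y \<in> H" by (auto simp: sink_connected_component_def)
  have H_prof: "H \<subseteq> profiles S" using H(1) by (simp add: sink_connected_component_def attracting_def)
  have qy: "?po (pure q) (pure y)"
    using H(2) y by (intro pseudo_orbit_response_path[OF \<phi> q(1)]) auto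
  have y_prof: "y \<in> profiles S" using y H_prof by blast
  let ?E = "{(x, y). chain_recurrent ?X \<phi> x \<and> chain_recurrent ?X \<phi> y \<and> chain_equivalent ?X \<phi> x y}"
  define C where "C = ?E `` {pure y}"
  have rec: "chain_recurrent ?X \<phi> (pure h)" if "h \<in> profiles S" for h
    using pseudo_orbit_pure_refl[OF \<phi> that] by (simp add: chain_recurrent_def chain_equivalent_def)
  have C_iff: "z \<in> C \<longleftrightarrow> chain_recurrent ?X \<phi> z \<and> ?po (pure y) z \<and> ?po z (pure y)" for z
    using rec[OF y_prof] by (auto simp: C_def chain_equivalent_def)
  have "C \<in> chain_components ?X \<phi>"
    unfolding chain_components_def C_def using rec[OF y_prof] by (intro quotientI) simp
  \<comment> \<open>A point \<open>z\<close> reached from the component leads on to some pure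
    \<open>q'\<close>. It lies in \<open>D q\<close>, so it leads back to \<open>q\<close> and from
    there to \<open>y\<close>.\<close>
  moreover have "z \<in> C" if "c \<in> C" "chain_recurrent ?X \<phi> z" "?po c z" for c z
  proof -
    have yz: "?po (pure y) z" using that C_iff pseudo_orbit_trans by blast
    have "z \<in> ?X"
      using yz by (auto simp: pseudo_orbit_iff dest!: spec[of _ 1] chain_step_trancl_in)
    then obtain q' where q': "q' \<in> profiles S" "?po z (pure q')"
      using pseudo_orbit_to_pure[OF \<phi>] by blast
    then have "q' \<in> D q" using qy yz pseudo_orbit_trans unfolding D_def by blast
    then have "?po z (pure y)" using returns q' qy pseudo_orbit_trans by blast
    then show ?thesis using yz that(2) by (simp add: C_iff)
  qed
  ultimately have "sink_chain_component ?X \<phi> C" by (auto simp: sink_chain_component_def)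
  moreover have "pure ` H \<subseteq> C"
  proof clarify
    fix h assume h: "h \<in> H"
    show "pure h \<in> C"
      unfolding C_iff
      using rec h y H_prof pseudo_orbit_response_path[OF \<phi>]
        sink_connected_component_strongly_connected[OF H(1)] by blast
  qed
  moreover have "?po x (pure y)" using q(2) qy by (rule pseudo_orbit_trans)
  ultimately show ?thesis using H(1) y by blast
qed

end
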